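(* Let $(X,\mathcal{B},\mu)$ be a probability measure space and let $T_1,T_2,T_3$ be three (not necessarily commuting) measure preserving transformations on $(X,\mathcal{B},\mu)$. Then for all bounded measurable functions $f_1,f_2,f_3$ on $X$ the averages $$\frac{1}{N^2}\sum_{n,m=1}^N f_1(T_1^n x)\,f_2(T_2^m x)\,f_3(T_3^{n+m}x)$$ converge as $N\to\infty$ for $\mu$-almost every $x\in X$.
   Context: A measure preserving transformation on $(X,\mathcal{B},\mu)$ is a measurable map $T:X\to X$ with $\mu(T^{-1}B)=\mu(B)$ for all $B\in\mathcal{B}$. Functions are scalar (complex) valued. *)

theory Defs
  imports "HOL-Probability.Probability"
begin

definition measure_preserving :: "'a measure \<Rightarrow> ('a \<Rightarrow> 'a) \<Rightarrow> bool" where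
  "measure_preserving M T \<longleftrightarrow>
     T \<in> measurable M M \<and>
     (\<forall>B\<in>sets M. emeasure M (T -` B \<inter> space M) = emeasure M B)"

end

theory Submission
  imports Defs
begin

text \<open>
  Call a bounded sequence $c$ trigonometrically approximable if for every $\epsilon > 0$ some
  trigonometric polynomial $p$ satisfies
  $|N^{-1} \sum_{n<N} (c_n - p_n) z^n| \le \epsilon$ for all large $N$, uniformly in $|z| = 1$.
  If $a$, $b$, $c$ are approximable, then $N^{-2} \sum_{n,m} a_n b_m c_{n+m}$ converges: for a
  polynomial in place of $c$ the average splits into products of averages of $a_n z^n$ and
  $b_m z^m$, and the remainder is controlled by Parseval's identity modulo $2N + 1$.

  It remains to see that almost every orbit sequence $f(T^n x)$ is approximable. The energies
  $W_K(x,z) = \lim_N N^{-1} \sum_{n<N} |K^{-1} \sum_{h<K} f(T^{n+h} x) z^h|^2$ exist almost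
  everywhere by Birkhoff's theorem, decrease along $K = 2^k$, and by van der Corput bound the
  squared exponential averages uniformly in $z$. Choose measurably a $z(x)$ maximising
  $\lim_k W_{2^k}(x, \cdot)$; it is $T$-invariant because $W$ is. Birkhoff's theorem on the skew
  product $(x,s) \mapsto (Tx, s + \theta(x))$ yields $B(x) = \lim_N N^{-1} \sum_{n<N} f(T^n x) z(x)^n$, where
  $z(x) = e^{2 \pi i \theta(x)}$, and an
  integral comparison shows that $|B(x)|^2$ equals that maximum. Replacing $f$ by $f - B$ removes one
  frequency and lowers the mean energy of the orbit by $|B(x)|^2$. Iterating, the maxima are
  summable, hence tend to $0$. No ergodicity is needed, since the frequencies may depend on $x$.
\<close>

section \<open>Cesaro means\<close>

text \<open>Averaging over \<open>n < N\<close> starts at exponent 0, which suits powers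
  \<open>z ^ n\<close> and blocks; at \<open>N = 0\<close> division by zero gives the value
  0.\<close>

definition cesaro :: "(nat \<Rightarrow> 'b::real_normed_field) \<Rightarrow> nat \<Rightarrow> 'b" where
  "cesaro c N = (\<Sum>n<N. c n) / of_nat N"

lemma norm_cesaro_le:
  assumes "\<And>n. norm (c n) \<le> C"
  shows "norm (cesaro c N) \<le> C"
proof (cases "N = 0")
  case True
  then show ?thesis using assms[of 0] norm_ge_zero[of "c 0"] by (simp add: cesaro_def del: norm_ge_zero)
next
  case False
  have "norm (\<Sum>n<N. c n) \<le> (\<Sum>n<N. C)"
    by (intro sum_norm_le assms)
  then show ?thesis using False
    by (simp add: cesaro_def norm_divide field_simps)
qed

lemma cesaro_add: "cesaro (\<lambda>n. c n + d n) N = cesaro c N + cesaro d N"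
  by (simp add: cesaro_def sum.distrib add_divide_distrib)

lemma cesaro_diff: "cesaro (\<lambda>n. c n - d n) N = cesaro c N - cesaro d N"
  by (simp add: cesaro_def sum_subtractf diff_divide_distrib)

lemma cesaro_cmult: "cesaro (\<lambda>n. a * c n) N = a * cesaro c N"
  by (simp add: cesaro_def sum_distrib_left)

lemma cesaro_sum: "cesaro (\<lambda>n. \<Sum>i\<in>I. c i n) N = (\<Sum>i\<in>I. cesaro (c i) N)"
  unfolding cesaro_def sum_divide_distrib by (rule sum.swap)

lemma cesaro_mono:
  fixes c d :: "nat \<Rightarrow> real"
  assumes "\<And>n. c n \<le> d n"
  shows "cesaro c N \<le> cesaro d N"
  unfolding cesaro_def by (intro divide_right_mono sum_mono assms) auto

text \<open>Raising the shift by one drops one term and adds another, at a cost of at most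
  \<open>2 * C\<close>.\<close>

lemma norm_sum_shift_le:
  fixes c :: "nat \<Rightarrow> 'b::real_normed_field"
  assumes "\<And>n. norm (c n) \<le> C"
  shows "norm ((\<Sum>n<N. c (n + h)) - (\<Sum>n<N. c n)) \<le> 2 * real h * C"
proof (induction h)
  case (Suc h)
  have "(\<Sum>n<N. c (n + Suc h)) = (\<Sum>n<N. c (n + h)) + c (N + h) - c h"
    by (induction N) auto
  then have "(\<Sum>n<N. c (n + Suc h)) - (\<Sum>n<N. c n)
      = ((\<Sum>n<N. c (n + h)) - (\<Sum>n<N. c n)) + (c (N + h) - c h)" by simp
  also have "norm \<dots> \<le> 2 * real h * C + (C + C)"
    by (intro norm_triangle_mono[OF Suc] norm_triangle_le_diff add_mono assms)
  finally show ?case by (simp add: algebra_simps)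
qed simp

lemma cesaro_shift_tendsto_0:
  fixes c :: "nat \<Rightarrow> 'b::real_normed_field"
  assumes "\<And>n. norm (c n) \<le> C"
  shows "(\<lambda>N. cesaro (\<lambda>n. c (n + h)) N - cesaro c N) \<longlonglongrightarrow> 0"
proof (rule Lim_null_comparison)
  show "\<forall>\<^sub>F N in sequentially. norm (cesaro (\<lambda>n. c (n + h)) N - cesaro c N) \<le> (2 * real h * C) / real N"
    using norm_sum_shift_le[of c C, OF assms]
    by (intro always_eventually allI) (simp add: cesaro_def diff_divide_distrib[symmetric] norm_divide divide_right_mono)
  show "(\<lambda>N. (2 * real h * C) / real N) \<longlonglongrightarrow> 0"
    by (rule lim_const_over_n)
qed

lemma cesaro_shift_iff:
  fixes c :: "nat \<Rightarrow> 'b::real_normed_field"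
  assumes "\<And>n. norm (c n) \<le> C"
  shows "cesaro (\<lambda>n. c (n + h)) \<longlonglongrightarrow> L \<longleftrightarrow> cesaro c \<longlonglongrightarrow> L"
  using Lim_transform_eq[OF cesaro_shift_tendsto_0[of c C h, OF assms]] by simp

section \<open>Birkhoff's ergodic theorem\<close>

locale mpt = prob_space M for M :: "'a measure" +
  fixes T :: "'a \<Rightarrow> 'a"
  assumes measure_preserving: "measure_preserving M T"
begin

section \<open>Iterates of a measure preserving map and invariance of integrals\<close>

lemma measurable_T [measurable]: "T \<in> measurable M M"
  using measure_preserving by (simp add: measure_preserving_def)

lemma distr_T: "distr M M T = M"
  using measure_preserving
  by (intro measure_eqI) (auto simp: measure_preserving_def emeasure_distr)

lemma T_pow_in_space [simp]: "x \<in> space M \<Longrightarrow> (T ^^ n) x \<in> space M"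
  by (induction n) (auto intro: measurable_space[OF measurable_T])

lemma T_in_space [simp]: "x \<in> space M \<Longrightarrow> T x \<in> space M"
  by (rule measurable_space[OF measurable_T])

lemma measurable_T_pow [measurable]: "T ^^ n \<in> measurable M M"
  by (induction n) (auto simp: comp_def id_def)

lemma distr_T_pow: "distr M M (T ^^ n) = M"
proof (induction n)
  case (Suc n)
  have "distr M M (T ^^ Suc n) = distr (distr M M (T ^^ n)) M T"
    by (subst distr_distr) (auto simp: comp_def)
  then show ?case by (simp only: Suc distr_T)
qed (simp add: id_def)

lemma integral_T_pow:
  fixes f :: "'a \<Rightarrow> 'b::{banach, second_countable_topology}"
  assumes [measurable]: "f \<in> borel_measurable M"
  shows "(\<integral>x. f ((T ^^ n) x) \<partial>M) = (\<integral>x. f x \<partial>M)"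
  using integral_distr[of "T ^^ n" M M f] by (simp add: distr_T_pow)

lemma integrable_T_pow:
  fixes f :: "'a \<Rightarrow> 'b::{banach, second_countable_topology}"
  assumes "integrable M f"
  shows "integrable M (\<lambda>x. f ((T ^^ n) x))"
  using integrable_distr[of "T ^^ n" M M f] assms by (simp add: distr_T_pow)

lemma integral_T:
  fixes f :: "'a \<Rightarrow> 'b::{banach, second_countable_topology}"
  assumes [measurable]: "f \<in> borel_measurable M"
  shows "(\<integral>x. f (T x) \<partial>M) = (\<integral>x. f x \<partial>M)"
  using integral_T_pow[of f 1] by simp

lemma integrable_T:
  fixes f :: "'a \<Rightarrow> 'b::{banach, second_countable_topology}"
  assumes "integrable M f"
  shows "integrable M (\<lambda>x. f (T x))"
  using integrable_T_pow[of f 1] assms by simp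

text \<open>This is the maximum of 0 and the orbit sums of lengths 1 to \<open>n\<close>. The
  recursion uses that the sum of length \<open>k + 1\<close> from \<open>x\<close> is
  \<open>f x\<close> plus the sum of length \<open>k\<close> from \<open>T x\<close>.\<close>

primrec maximal_sum :: "('a \<Rightarrow> real) \<Rightarrow> nat \<Rightarrow> 'a \<Rightarrow> real" where
  "maximal_sum f 0 x = 0"
| "maximal_sum f (Suc n) x = max 0 (f x + maximal_sum f n (T x))"

lemma maximal_sum_nonneg: "0 \<le> maximal_sum f n x"
  by (cases n) auto

lemma maximal_sum_Suc_mono: "maximal_sum f n x \<le> maximal_sum f (Suc n) x"
proof (induction n arbitrary: x)
  case (Suc n)
  show ?case using Suc[of "T x"] by auto
qed simp

lemma sum_le_maximal_sum: "(\<Sum>i<n. f ((T ^^ i) x)) \<le> maximal_sum f n x"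
proof (induction n arbitrary: x)
  case (Suc n)
  have "(\<Sum>i<Suc n. f ((T ^^ i) x)) = f x + (\<Sum>i<n. f ((T ^^ i) (T x)))"
    by (subst sum.lessThan_Suc_shift) (simp add: funpow_swap1)
  also have "\<dots> \<le> maximal_sum f (Suc n) x" using Suc[of "T x"] by simp
  finally show ?case .
qed simp

lemma measurable_maximal_sum [measurable]:
  assumes [measurable]: "f \<in> borel_measurable M"
  shows "maximal_sum f n \<in> borel_measurable M"
proof (induction n)
  case 0
  have "maximal_sum f 0 = (\<lambda>x. 0)" by auto
  then show ?case by simp
next
  case (Suc n)
  note Suc [measurable]
  have "maximal_sum f (Suc n) = (\<lambda>x. max 0 (f x + maximal_sum f n (T x)))" by auto
  then show ?case by simp
qed

lemma integrable_maximal_sum: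
  assumes f: "integrable M f"
  shows "integrable M (maximal_sum f n)"
proof (induction n)
  case (Suc n)
  have "integrable M (\<lambda>x. f x + maximal_sum f n (T x))"
    using f integrable_T[OF Suc] by simp
  then have "integrable M (\<lambda>x. max 0 (f x + maximal_sum f n (T x)))"
    by simp
  moreover have "maximal_sum f (Suc n) = (\<lambda>x. max 0 (f x + maximal_sum f n (T x)))" by auto
  ultimately show ?case by simp
next
  case 0
  have "maximal_sum f 0 = (\<lambda>x. 0)" by auto
  then show ?case by simp
qed

text \<open>Garsia's argument. Let \<open>m\<close> be \<open>maximal_sum f (Suc n)\<close>. Where
  \<open>m x > 0\<close>, the recursion and monotonicity in \<open>n\<close> give
  \<open>m x - m (T x) \<le> f x\<close>; elsewhere the left side is at most 0. Its integral
  vanishes by invariance, so the integral of \<open>f\<close> over the set where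
  \<open>m > 0\<close> is nonnegative. These sets exhaust the space by \<open>pos\<close>, and
  dominated convergence finishes.\<close>

lemma maximal_ergodic_inequality:
  fixes f :: "'a \<Rightarrow> real"
  assumes f: "integrable M f"
    and pos: "\<And>x. x \<in> space M \<Longrightarrow> \<exists>n. 0 < (\<Sum>i<n. f ((T ^^ i) x))"
  shows "0 \<le> (\<integral>x. f x \<partial>M)"
proof -
  have [measurable]: "f \<in> borel_measurable M" using f by auto
  let ?m = "maximal_sum f"
  define I where "I n x = (if 0 < ?m (Suc n) x then f x else 0)" for n x
  have I_meas [measurable]: "I n \<in> borel_measurable M" for n
    unfolding I_def by measurable
  have I_int: "integrable M (I n)" for n
    by (rule Bochner_Integration.integrable_bound[OF f]) (auto simp: I_def)
  have nonneg: "0 \<le> (\<integral>x. I n x \<partial>M)" for n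
  proof -
    have "0 = (\<integral>x. ?m (Suc n) x - ?m (Suc n) (T x) \<partial>M)"
      using integrable_maximal_sum[OF f, of "Suc n"]
      by (subst Bochner_Integration.integral_diff)
        (auto intro: integrable_T simp: integral_T simp del: maximal_sum.simps)
    also have "\<dots> \<le> (\<integral>x. I n x \<partial>M)"
    proof (intro integral_mono Bochner_Integration.integrable_diff
        integrable_T[OF integrable_maximal_sum[OF f]] integrable_maximal_sum[OF f] I_int)
      fix x
      show "?m (Suc n) x - ?m (Suc n) (T x) \<le> I n x"
        using maximal_sum_Suc_mono[of f n "T x"] maximal_sum_nonneg[of f "Suc n" "T x"]
        by (auto simp: I_def simp del: maximal_sum.simps(2)) (auto split: if_splits)
    qed
    finally show ?thesis .
  qed
  have "(\<lambda>n. \<integral>x. I n x \<partial>M) \<longlonglongrightarrow> (\<integral>x. f x \<partial>M)"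
  proof (rule integral_dominated_convergence[where w = "\<lambda>x. \<bar>f x\<bar>"])
    show "AE x in M. (\<lambda>n. I n x) \<longlonglongrightarrow> f x"
    proof (rule AE_I2)
      fix x assume "x \<in> space M"
      then obtain k where k: "0 < (\<Sum>i<k. f ((T ^^ i) x))" using pos by blast
      have "I n x = f x" if "n \<ge> k" for n
      proof -
        have "?m k x \<le> ?m (Suc n) x"
          by (rule lift_Suc_mono_le[of "\<lambda>n. ?m n x"]) (use that maximal_sum_Suc_mono in auto)
        then show ?thesis using k sum_le_maximal_sum[of f x k] by (simp add: I_def del: maximal_sum.simps)
      qed
      then show "(\<lambda>n. I n x) \<longlonglongrightarrow> f x"
        by (intro tendsto_eventually eventually_sequentiallyI[of k])
    qed
  qed (use f in \<open>auto simp: I_def\<close>)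
  then show ?thesis by (rule LIMSEQ_le_const) (use nonneg in auto)
qed

text \<open>One half of Birkhoff's theorem: used for both \<open>f\<close> and \<open>- f\<close>,
  it squeezes the upper and lower limits together. Since all averages lie between \<open>- C\<close>
  and \<open>C\<close>, the upper limit is finite and \<open>real_of_ereal\<close> loses
  nothing.\<close>

lemma integral_limsup_cesaro_le:
  fixes f :: "'a \<Rightarrow> real"
  assumes [measurable]: "f \<in> borel_measurable M"
    and bd: "\<And>x. x \<in> space M \<Longrightarrow> \<bar>f x\<bar> \<le> C"
  defines "F \<equiv> (\<lambda>x. real_of_ereal (limsup (\<lambda>N. ereal (cesaro (\<lambda>n. f ((T ^^ n) x)) N))))"
  shows "integrable M F" "(\<integral>x. F x \<partial>M) \<le> (\<integral>x. f x \<partial>M)"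
    "\<And>x. x \<in> space M \<Longrightarrow> limsup (\<lambda>N. ereal (cesaro (\<lambda>n. f ((T ^^ n) x)) N)) = ereal (F x)"
proof -
  let ?A = "\<lambda>x. cesaro (\<lambda>n. f ((T ^^ n) x))"
  have A_bd: "\<bar>?A x N\<bar> \<le> C" if "x \<in> space M" for x N
    using norm_cesaro_le[of "\<lambda>n. f ((T ^^ n) x)" C N] bd that by simp
  have lim_bd: "limsup (\<lambda>N. ereal (?A x N)) \<le> ereal C" "ereal (- C) \<le> limsup (\<lambda>N. ereal (?A x N))"
    if "x \<in> space M" for x
  proof -
    show "limsup (\<lambda>N. ereal (?A x N)) \<le> ereal C"
      using A_bd[OF that] by (intro Limsup_bounded always_eventually) (auto simp: abs_le_iff)
    have "ereal (- C) \<le> liminf (\<lambda>N. ereal (?A x N))"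
      using A_bd[OF that] by (intro Liminf_bounded always_eventually) (auto simp: abs_le_iff minus_le_iff)
    also have "\<dots> \<le> limsup (\<lambda>N. ereal (?A x N))" by (rule Liminf_le_Limsup) simp
    finally show "ereal (- C) \<le> limsup (\<lambda>N. ereal (?A x N))" .
  qed
  show F: "limsup (\<lambda>N. ereal (?A x N)) = ereal (F x)" if "x \<in> space M" for x
    using lim_bd[OF that] unfolding F_def
    by (cases "limsup (\<lambda>N. ereal (?A x N))") auto
  have F_bd: "\<bar>F x\<bar> \<le> C" if "x \<in> space M" for x
    using lim_bd[OF that] F[OF that] by (auto simp: abs_le_iff)
  have [measurable]: "F \<in> borel_measurable M"
    unfolding F_def cesaro_def by measurable
  show intF: "integrable M F"
    by (rule integrable_const_bound[of _ C]) (use F_bd in auto)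
  have intf: "integrable M f"
    by (rule integrable_const_bound[of _ C]) (use bd in auto)
  have F_inv: "F ((T ^^ n) x) = F x" if "x \<in> space M" for n x
  proof -
    have *: "(\<lambda>N. ?A ((T ^^ n) x) N - ?A x N) \<longlonglongrightarrow> 0"
      using cesaro_shift_tendsto_0[of "\<lambda>n. f ((T ^^ n) x)" C n] bd that by (simp add: funpow_add)
    have "limsup (\<lambda>N. ereal (?A ((T ^^ n) x) N)) = limsup (\<lambda>N. ereal (?A x N) + ereal (?A ((T ^^ n) x) N - ?A x N))"
      by simp
    also have "\<dots> = 0 + limsup (\<lambda>N. ereal (?A x N))"
      by (subst add.commute, rule ereal_limsup_lim_add) (use * in \<open>auto simp: zero_ereal_def\<close>)
    finally show ?thesis by (simp add: F_def)
  qed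
  show "(\<integral>x. F x \<partial>M) \<le> (\<integral>x. f x \<partial>M)"
  proof (rule field_le_epsilon)
    fix e :: real assume e: "e > 0"
    \<comment> \<open>\<open>F\<close> is invariant, so the averages of \<open>f - F + e\<close> have upper limit \<open>e > 0\<close> everywhere.\<close>
    have "0 \<le> (\<integral>x. f x - F x + e \<partial>M)"
    proof (rule maximal_ergodic_inequality)
      show "integrable M (\<lambda>x. f x - F x + e)" using intf intF by auto
      fix x assume x: "x \<in> space M"
      have "frequently (\<lambda>N. ereal (F x - e) < ereal (?A x N)) sequentially"
      proof (rule ccontr)
        assume "\<not> ?thesis"
        then have "limsup (\<lambda>N. ereal (?A x N)) \<le> ereal (F x - e)"
          by (intro Limsup_bounded) (simp add: not_frequently not_less)
        then show False using F[OF x] e by simp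
      qed
      then obtain N where N: "N \<ge> 1" "F x - e < ?A x N"
        by (auto simp: frequently_sequentially)
      have "(\<Sum>i<N. f ((T ^^ i) x) - F ((T ^^ i) x) + e) = real N * (?A x N - F x + e)"
        using N x by (simp add: F_inv sum.distrib sum_subtractf cesaro_def field_simps)
      then show "\<exists>n. 0 < (\<Sum>i<n. f ((T ^^ i) x) - F ((T ^^ i) x) + e)"
        using N by (intro exI[of _ N]) auto
    qed
    then show "(\<integral>x. F x \<partial>M) \<le> (\<integral>x. f x \<partial>M) + e"
      using intf intF by (simp add: prob_space)
  qed
qed

text \<open>With upper limit \<open>F\<close> and lower limit \<open>- G\<close>, the gap
  \<open>F + G\<close> is nonnegative pointwise, while the integral bounds for \<open>f\<close> and
  \<open>- f\<close> add up to at most 0. Hence the gap vanishes almost everywhere.\<close>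

lemma birkhoff_real:
  fixes f :: "'a \<Rightarrow> real"
  assumes [measurable]: "f \<in> borel_measurable M"
    and bd: "\<And>x. x \<in> space M \<Longrightarrow> \<bar>f x\<bar> \<le> C"
  shows "AE x in M. convergent (cesaro (\<lambda>n. f ((T ^^ n) x)))"
proof -
  let ?A = "\<lambda>x N. ereal (cesaro (\<lambda>n. f ((T ^^ n) x)) N)"
  let ?B = "\<lambda>x N. ereal (cesaro (\<lambda>n. - f ((T ^^ n) x)) N)"
  define F where "F x = real_of_ereal (limsup (?A x))" for x
  define G where "G x = real_of_ereal (limsup (?B x))" for x
  have F: "integrable M F" "(\<integral>x. F x \<partial>M) \<le> (\<integral>x. f x \<partial>M)"
      "\<And>x. x \<in> space M \<Longrightarrow> limsup (?A x) = ereal (F x)"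
    unfolding F_def using integral_limsup_cesaro_le[of f C] bd by auto
  have G: "integrable M G" "(\<integral>x. G x \<partial>M) \<le> - (\<integral>x. f x \<partial>M)"
      "\<And>x. x \<in> space M \<Longrightarrow> limsup (?B x) = ereal (G x)"
    unfolding G_def using integral_limsup_cesaro_le[of "\<lambda>x. - f x" C] bd by auto
  have B: "?B x = (\<lambda>N. - ?A x N)" for x
    by (auto simp: cesaro_def sum_negf)
  have liminf: "liminf (?A x) = ereal (- G x)" if "x \<in> space M" for x
  proof -
    have "- liminf (?A x) = ereal (G x)"
      using G(3)[OF that] unfolding B ereal_Limsup_uminus .
    then have "- (- liminf (?A x)) = - ereal (G x)" by (rule arg_cong)
    then show ?thesis by simp
  qed
  have nonneg: "0 \<le> F x + G x" if "x \<in> space M" for x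
    using Liminf_le_Limsup[of sequentially "?A x"] liminf[OF that] F(3)[OF that] by simp
  have "(\<integral>x. F x + G x \<partial>M) = 0"
    using F(1,2) G(1,2) nonneg
    by (intro antisym Bochner_Integration.integral_nonneg) (auto simp: Bochner_Integration.integral_add)
  then have "AE x in M. F x + G x = 0"
    using F(1) G(1) nonneg by (subst (asm) integral_nonneg_eq_0_iff_AE) auto
  then show ?thesis
  proof (rule AE_mp, intro AE_I2 impI)
    fix x assume x: "x \<in> space M" and "F x + G x = 0"
    then have "?A x \<longlonglongrightarrow> ereal (F x)"
      using F(3)[OF x] liminf[OF x] by (intro Liminf_eq_Limsup) auto
    then show "convergent (cesaro (\<lambda>n. f ((T ^^ n) x)))"
      by (auto simp: convergent_def)
  qed
qed

theorem birkhoff: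
  fixes f :: "'a \<Rightarrow> complex"
  assumes [measurable]: "f \<in> borel_measurable M"
    and bd: "\<And>x. x \<in> space M \<Longrightarrow> norm (f x) \<le> C"
  shows "AE x in M. convergent (cesaro (\<lambda>n. f ((T ^^ n) x)))"
proof -
  have "AE x in M. convergent (cesaro (\<lambda>n. Re (f ((T ^^ n) x))))"
    by (rule birkhoff_real[of _ C]) (auto intro: order_trans[OF abs_Re_le_cmod bd])
  moreover have "AE x in M. convergent (cesaro (\<lambda>n. Im (f ((T ^^ n) x))))"
    by (rule birkhoff_real[of _ C]) (auto intro: order_trans[OF abs_Im_le_cmod bd])
  ultimately show ?thesis
  proof eventually_elim
    case (elim x)
    then obtain a b where ab: "cesaro (\<lambda>n. Re (f ((T ^^ n) x))) \<longlonglongrightarrow> a"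
      "cesaro (\<lambda>n. Im (f ((T ^^ n) x))) \<longlonglongrightarrow> b" by (auto simp: convergent_def)
    have "cesaro (\<lambda>n. f ((T ^^ n) x)) =
        (\<lambda>N. Complex (cesaro (\<lambda>n. Re (f ((T ^^ n) x))) N) (cesaro (\<lambda>n. Im (f ((T ^^ n) x))) N))"
      by (auto simp: cesaro_def complex_eq_iff)
    then show ?case using tendsto_Complex[OF ab] by (auto simp: convergent_def)
  qed
qed

end

section \<open>Birkhoff averages twisted by an invariant frequency\<close>

lemma nn_integral_lborel_shift:
  assumes "F \<in> borel_measurable borel"
  shows "(\<integral>\<^sup>+s. F (s + t) \<partial>lborel) = (\<integral>\<^sup>+s. F s \<partial>(lborel :: real measure))"
  using nn_integral_real_affine[of F 1 t] assms by (simp add: add.commute)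

text \<open>With \<open>r = frac t\<close>, cut the unit interval at \<open>1 - r\<close>: the lower
  piece is translated by \<open>r\<close> onto \<open>{r..<1}\<close>, the upper one by
  \<open>r - 1\<close> onto \<open>{0..<r}\<close>. Translation invariance applies to each
  piece.\<close>

lemma nn_integral_rotation:
  fixes F :: "real \<Rightarrow> ennreal" and t :: real
  assumes [measurable]: "F \<in> borel_measurable borel"
  shows "(\<integral>\<^sup>+s. F (frac (s + t)) * indicator {0..<1} s \<partial>lborel) = (\<integral>\<^sup>+s. F s * indicator {0..<1} s \<partial>lborel)"
proof -
  define r where "r = frac t"
  have r: "0 \<le> r" "r < 1" by (auto simp: r_def frac_lt_1)
  have frac_r: "frac (s + t) = frac (s + r)" for s
    by (simp add: r_def)
  have *: "F (frac (s + t)) * indicator {0..<1} s =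
      F (s + r) * indicator {r..<1} (s + r) + F (s + (r - 1)) * indicator {0..<r} (s + (r - 1))" for s
  proof -
    have fr: "frac (s + t) = (if s + r < 1 then s + r else s + r - 1)" if "0 \<le> s" "s < 1"
    proof -
      have "frac (s + t) = frac (s + r)" by (rule frac_r)
      also have "\<dots> = (if s + r < 1 then s + r else s + r - 1)"
        using that r by (auto simp: frac_unique_iff)
      finally show ?thesis .
    qed
    show ?thesis
    proof (cases "0 \<le> s \<and> s < 1")
      case True
      then show ?thesis using fr r by (auto simp: indicator_def algebra_simps)
    next
      case False
      then show ?thesis using r by (auto simp: indicator_def)
    qed
  qed
  have "(\<integral>\<^sup>+s. F (frac (s + t)) * indicator {0..<1} s \<partial>lborel) =
      (\<integral>\<^sup>+s. F (s + r) * indicator {r..<1} (s + r) \<partial>lborel)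
      + (\<integral>\<^sup>+s. F (s + (r - 1)) * indicator {0..<r} (s + (r - 1)) \<partial>lborel)"
    unfolding * by (rule nn_integral_add) auto
  also have "\<dots> = (\<integral>\<^sup>+s. F s * indicator {r..<1} s \<partial>lborel) + (\<integral>\<^sup>+s. F s * indicator {0..<r} s \<partial>lborel)"
    by (intro arg_cong2[where f = "(+)"] nn_integral_lborel_shift[where F = "\<lambda>s. F s * indicator _ s"]) auto
  also have "\<dots> = (\<integral>\<^sup>+s. F s * indicator {r..<1} s + F s * indicator {0..<r} s \<partial>lborel)"
    by (rule nn_integral_add[symmetric]) auto
  also have "\<dots> = (\<integral>\<^sup>+s. F s * indicator {0..<1} s \<partial>lborel)"
    using r by (intro nn_integral_cong) (auto simp: indicator_def)
  finally show ?thesis .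
qed

text \<open>The circle with normalised Lebesgue measure. Its carrier is all of the real line, so
  measurability is plain Borel measurability and rotations can be written
  \<open>frac (s + t)\<close>.\<close>

definition unit_interval_measure :: "real measure" where
  "unit_interval_measure = density lborel (indicator {0..<1})"

lemma sets_unit_interval_measure [simp, measurable_cong]: "sets unit_interval_measure = sets borel"
  by (simp add: unit_interval_measure_def)

lemma space_unit_interval_measure [simp]: "space unit_interval_measure = UNIV"
  by (simp add: unit_interval_measure_def)

lemma nn_integral_unit_interval_measure:
  assumes "F \<in> borel_measurable borel"
  shows "(\<integral>\<^sup>+s. F s \<partial>unit_interval_measure) = (\<integral>\<^sup>+s. F s * indicator {0..<1} s \<partial>lborel)"
  unfolding unit_interval_measure_def using assms
  by (subst nn_integral_density) (auto simp: mult.commute)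

lemma prob_space_unit_interval_measure: "prob_space unit_interval_measure"
proof
  show "emeasure unit_interval_measure (space unit_interval_measure) = 1"
    by (simp add: unit_interval_measure_def emeasure_density)
qed

lemma borel_measurable_frac [measurable]: "frac \<in> borel_measurable (borel :: real measure)"
  unfolding frac_def by measurable

lemma nn_integral_unit_interval_rotation:
  assumes F: "F \<in> borel_measurable borel"
  shows "(\<integral>\<^sup>+s. F (frac (s + t)) \<partial>unit_interval_measure) = (\<integral>\<^sup>+s. F s \<partial>unit_interval_measure)"
proof -
  have *: "(\<lambda>s. F (frac (s + t))) \<in> borel_measurable borel"
    by (rule measurable_compose[OF _ F]) measurable
  show ?thesis
    unfolding nn_integral_unit_interval_measure[OF F] nn_integral_unit_interval_measure[OF *]
    by (rule nn_integral_rotation[OF F])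
qed

lemma cis_2pi_frac: "cis (2 * pi * frac s) = cis (2 * pi * s)"
proof -
  have "cis (2 * pi * s) = cis (2 * pi * frac s + 2 * pi * of_int \<lfloor>s\<rfloor>)"
    by (simp add: frac_def algebra_simps)
  also have "\<dots> = cis (2 * pi * frac s) * cis (2 * pi * of_int \<lfloor>s\<rfloor>)" by (simp only: cis_mult)
  also have "cis (2 * pi * of_int \<lfloor>s\<rfloor>) = 1" by (rule cis_multiple_2pi) simp
  finally show ?thesis by simp
qed

lemma borel_measurable_cis [measurable]: "cis \<in> borel_measurable borel"
  by (intro borel_measurable_continuous_onI continuous_intros)

lemma borel_measurable_cnj [measurable]: "cnj \<in> borel_measurable borel"
  by (intro borel_measurable_continuous_onI continuous_intros)

section \<open>Skew products over the base transformation\<close>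

context mpt
begin

lemma nn_integral_T:
  assumes "f \<in> borel_measurable M"
  shows "(\<integral>\<^sup>+x. f (T x) \<partial>M) = (\<integral>\<^sup>+x. f x \<partial>M)"
  using nn_integral_distr[of T M M f] assms by (simp add: distr_T)

lemma mpt_skew_product:
  assumes [measurable]: "\<theta> \<in> borel_measurable M"
  shows "mpt (M \<Otimes>\<^sub>M unit_interval_measure) (\<lambda>(x, s). (T x, frac (s + \<theta> x)))"
proof -
  interpret U: prob_space unit_interval_measure by (rule prob_space_unit_interval_measure)
  interpret P: pair_prob_space M unit_interval_measure ..
  let ?T = "\<lambda>(x, s). (T x, frac (s + \<theta> x))"
  have meas [measurable]: "?T \<in> measurable (M \<Otimes>\<^sub>M unit_interval_measure) (M \<Otimes>\<^sub>M unit_interval_measure)"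
    by measurable
  show ?thesis
  proof (unfold_locales, unfold measure_preserving_def, intro conjI ballI)
    fix B assume B [measurable]: "B \<in> sets (M \<Otimes>\<^sub>M unit_interval_measure)"
    have sec: "(\<lambda>s. indicator B (x, s) :: ennreal) \<in> borel_measurable borel" if "x \<in> space M" for x
    proof -
      have "(\<lambda>s. indicator B (x, s) :: ennreal) \<in> borel_measurable unit_interval_measure"
        using that by measurable
      then show ?thesis by simp
    qed
    have "emeasure (M \<Otimes>\<^sub>M unit_interval_measure) (?T -` B \<inter> space (M \<Otimes>\<^sub>M unit_interval_measure))
        = (\<integral>\<^sup>+x. \<integral>\<^sup>+s. indicator (?T -` B \<inter> space (M \<Otimes>\<^sub>M unit_interval_measure)) (x, s) \<partial>unit_interval_measure \<partial>M)"
      by (rule U.emeasure_pair_measure) measurable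
    also have "\<dots> = (\<integral>\<^sup>+x. \<integral>\<^sup>+s. indicator B (T x, frac (s + \<theta> x)) \<partial>unit_interval_measure \<partial>M)"
      by (intro nn_integral_cong) (auto simp: indicator_def space_pair_measure)
    also have "\<dots> = (\<integral>\<^sup>+x. \<integral>\<^sup>+s. indicator B (T x, s) \<partial>unit_interval_measure \<partial>M)"
    proof (rule nn_integral_cong)
      fix x assume x: "x \<in> space M"
      show "(\<integral>\<^sup>+s. indicator B (T x, frac (s + \<theta> x)) \<partial>unit_interval_measure)
          = (\<integral>\<^sup>+s. indicator B (T x, s) \<partial>unit_interval_measure)"
        by (rule nn_integral_unit_interval_rotation[OF sec[OF T_in_space[OF x]]])
    qed
    also have "\<dots> = (\<integral>\<^sup>+x. \<integral>\<^sup>+s. indicator B (x, s) \<partial>unit_interval_measure \<partial>M)"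
      by (rule nn_integral_T[where f = "\<lambda>x. \<integral>\<^sup>+s. indicator B (x, s) \<partial>unit_interval_measure"]) measurable
    also have "\<dots> = emeasure (M \<Otimes>\<^sub>M unit_interval_measure) B"
      by (rule U.emeasure_pair_measure[symmetric]) measurable
    finally show "emeasure (M \<Otimes>\<^sub>M unit_interval_measure) (?T -` B \<inter> space (M \<Otimes>\<^sub>M unit_interval_measure))
        = emeasure (M \<Otimes>\<^sub>M unit_interval_measure) B" .
  qed fact
qed

text \<open>Apply Birkhoff's theorem on the skew product to \<open>g x * cis (2 * pi * s)\<close>.
  As \<open>\<theta>\<close> is constant along orbits, the second coordinate advances by the same
  angle at each step and produces exactly the powers of
  \<open>cis (2 * pi * \<theta> x)\<close>.\<close>

theorem birkhoff_twisted:
  fixes g :: "'a \<Rightarrow> complex"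
  assumes [measurable]: "g \<in> borel_measurable M" "\<theta> \<in> borel_measurable M"
    and bd: "\<And>x. x \<in> space M \<Longrightarrow> norm (g x) \<le> C"
    and inv: "\<And>x. x \<in> space M \<Longrightarrow> \<theta> (T x) = \<theta> x"
  shows "AE x in M. convergent (cesaro (\<lambda>n. g ((T ^^ n) x) * cis (2 * pi * \<theta> x) ^ n))"
proof -
  interpret U: prob_space unit_interval_measure by (rule prob_space_unit_interval_measure)
  interpret P: pair_prob_space M unit_interval_measure ..
  let ?T = "\<lambda>(x, s). (T x, frac (s + \<theta> x))"
  interpret S: mpt "M \<Otimes>\<^sub>M unit_interval_measure" ?T by (rule mpt_skew_product) fact
  define F where "F = (\<lambda>(x, s). g x * cis (2 * pi * s))"
  have "AE p in M \<Otimes>\<^sub>M unit_interval_measure. convergent (cesaro (\<lambda>n. F ((?T ^^ n) p)))"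
  proof (rule S.birkhoff[of F C])
    show "F \<in> borel_measurable (M \<Otimes>\<^sub>M unit_interval_measure)"
      unfolding F_def by measurable
  qed (auto simp: F_def space_pair_measure norm_mult bd)
  then have "AE x in M. AE s in unit_interval_measure. convergent (cesaro (\<lambda>n. F ((?T ^^ n) (x, s))))"
    by (rule P.AE_pair)
  then show ?thesis
  proof (rule AE_mp, intro AE_I2 impI)
    fix x assume x: "x \<in> space M"
      and AE: "AE s in unit_interval_measure. convergent (cesaro (\<lambda>n. F ((?T ^^ n) (x, s))))"
    have \<theta>: "\<theta> ((T ^^ n) x) = \<theta> x" for n
      by (induction n) (use x inv in auto)
    \<comment> \<open>The second coordinate is followed only through \<open>cis\<close>, to which
      the reductions by \<open>frac\<close> are invisible.\<close>
    have iter: "fst ((?T ^^ n) (x, s)) = (T ^^ n) x"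
        "cis (2 * pi * snd ((?T ^^ n) (x, s))) = cis (2 * pi * s) * cis (2 * pi * \<theta> x) ^ n" for n s
    proof (induction n)
      case (Suc n)
      { case 1 then show ?case using Suc(1) by (simp add: case_prod_unfold) }
      { case 2 show ?case using Suc
          by (simp add: case_prod_unfold cis_2pi_frac \<theta> distrib_left flip: cis_mult) }
    qed auto
    have "cesaro (\<lambda>n. F ((?T ^^ n) (x, s))) =
        (\<lambda>N. cis (2 * pi * s) * cesaro (\<lambda>n. g ((T ^^ n) x) * cis (2 * pi * \<theta> x) ^ n) N)" for s
    proof -
      have "F ((?T ^^ n) (x, s)) = cis (2 * pi * s) * (g ((T ^^ n) x) * cis (2 * pi * \<theta> x) ^ n)" for n
      proof -
        have "F ((?T ^^ n) (x, s)) = g (fst ((?T ^^ n) (x, s))) * cis (2 * pi * snd ((?T ^^ n) (x, s)))"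
          by (simp add: F_def case_prod_unfold)
        then show ?thesis unfolding iter by (simp only: mult.left_commute)
      qed
      then show ?thesis by (simp add: cesaro_cmult fun_eq_iff)
    qed
    \<comment> \<open>The starting phase is a nonzero factor and cancels, so the claim no longer
      mentions \<open>s\<close>; holding for almost every \<open>s\<close> of a probability space,
      it holds outright.\<close>
    then have "AE s in unit_interval_measure. convergent (cesaro (\<lambda>n. g ((T ^^ n) x) * cis (2 * pi * \<theta> x) ^ n))"
      using AE by (simp add: convergent_mult_const_iff)
    then show "convergent (cesaro (\<lambda>n. g ((T ^^ n) x) * cis (2 * pi * \<theta> x) ^ n))"
      by simp
  qed
qed

end

section \<open>Block energies and van der Corput's inequality\<close>

definition has_correlations :: "(nat \<Rightarrow> complex) \<Rightarrow> bool" where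
  "has_correlations c \<longleftrightarrow> (\<forall>h k. convergent (cesaro (\<lambda>n. c (n + h) * cnj (c (n + k)))))"

text \<open>The twist restarts at the beginning of each block, so along an orbit with fixed
  \<open>z\<close> this is a function of the point reached after \<open>n\<close> steps. The missing
  phase \<open>z ^ n\<close> is supplied where it is needed.\<close>

definition block_mean :: "(nat \<Rightarrow> complex) \<Rightarrow> nat \<Rightarrow> complex \<Rightarrow> nat \<Rightarrow> complex" where
  "block_mean c K z n = cesaro (\<lambda>h. c (n + h) * z ^ h) K"

text \<open>For sequences with correlations this is the Cesaro limit of the squared block means; writing
  it through the correlations makes it a trigonometric polynomial in \<open>z\<close> for every sequence.\<close>

definition block_energy :: "(nat \<Rightarrow> complex) \<Rightarrow> nat \<Rightarrow> complex \<Rightarrow> real" where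
  "block_energy c K z = Re (\<Sum>h<K. \<Sum>k<K. z ^ h * cnj z ^ k *
     lim (cesaro (\<lambda>n. c (n + h) * cnj (c (n + k))))) / (real K)\<^sup>2"

text \<open>Finite counterpart of \<open>block_energy\<close>: the same quadratic form in the powers
  of \<open>z\<close>, with averages in place of their limits.\<close>

lemma cesaro_block_mean_sq:
  "cesaro (\<lambda>n. (norm (block_mean c K z n))\<^sup>2) N =
    Re (\<Sum>h<K. \<Sum>k<K. z ^ h * cnj z ^ k * cesaro (\<lambda>n. c (n + h) * cnj (c (n + k))) N) / (real K)\<^sup>2"
proof -
  have sq: "complex_of_real ((norm (block_mean c K z n))\<^sup>2) =
      (\<Sum>h<K. \<Sum>k<K. z ^ h * cnj z ^ k * (c (n + h) * cnj (c (n + k)))) / of_real ((real K)\<^sup>2)" for n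
    unfolding complex_norm_square block_mean_def cesaro_def
    by (simp add: sum_product power2_eq_square mult_ac)
  have "complex_of_real (cesaro (\<lambda>n. (norm (block_mean c K z n))\<^sup>2) N)
      = cesaro (\<lambda>n. complex_of_real ((norm (block_mean c K z n))\<^sup>2)) N"
    by (simp add: cesaro_def)
  also have "\<dots> = cesaro (\<lambda>n. (1 / of_real ((real K)\<^sup>2)) *
      (\<Sum>h<K. \<Sum>k<K. z ^ h * cnj z ^ k * (c (n + h) * cnj (c (n + k))))) N"
    unfolding sq by simp
  also have "\<dots> = (1 / of_real ((real K)\<^sup>2)) *
      (\<Sum>h<K. \<Sum>k<K. z ^ h * cnj z ^ k * cesaro (\<lambda>n. c (n + h) * cnj (c (n + k))) N)"
    by (simp only: cesaro_cmult cesaro_sum)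
  finally have "complex_of_real (cesaro (\<lambda>n. (norm (block_mean c K z n))\<^sup>2) N) =
      (\<Sum>h<K. \<Sum>k<K. z ^ h * cnj z ^ k * cesaro (\<lambda>n. c (n + h) * cnj (c (n + k))) N) / of_real ((real K)\<^sup>2)"
    by simp
  from arg_cong[OF this, of Re] show ?thesis by (simp only: Re_complex_of_real Re_divide_of_real)
qed

text \<open>The frequency enters only through the coefficients \<open>z ^ h * cnj z ^ k\<close> of
  modulus 1. Hence the errors of the finitely many correlations, collected in \<open>D\<close>,
  bound the difference for all \<open>z\<close> at once.\<close>

lemma block_energy_uniform_limit:
  assumes c: "has_correlations c" and e: "e > 0"
  shows "\<forall>\<^sub>F N in sequentially. \<forall>z. norm z = 1 \<longrightarrow>
    \<bar>cesaro (\<lambda>n. (norm (block_mean c K z n))\<^sup>2) N - block_energy c K z\<bar> < e"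
proof -
  let ?A = "\<lambda>h k. cesaro (\<lambda>n. c (n + h) * cnj (c (n + k)))"
  define D where "D N = (\<Sum>h<K. \<Sum>k<K. norm (?A h k N - lim (?A h k))) / (real K)\<^sup>2" for N
  have lim: "?A h k \<longlonglongrightarrow> lim (?A h k)" for h k
    using c by (simp add: has_correlations_def convergent_LIMSEQ_iff)
  have "D \<longlonglongrightarrow> (\<Sum>h<K. \<Sum>k<K. norm (lim (?A h k) - lim (?A h k))) / (real K)\<^sup>2"
    unfolding D_def divide_inverse by (intro tendsto_intros lim)
  then have "D \<longlonglongrightarrow> 0" by simp
  then have "\<forall>\<^sub>F N in sequentially. D N < e" using e by (rule order_tendstoD)
  then show ?thesis
  proof eventually_elim
    case (elim N)
    have "\<bar>cesaro (\<lambda>n. (norm (block_mean c K z n))\<^sup>2) N - block_energy c K z\<bar> \<le> D N" if z: "norm z = 1" for z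
    proof -
      have eq: "cesaro (\<lambda>n. (norm (block_mean c K z n))\<^sup>2) N - block_energy c K z =
          Re (\<Sum>h<K. \<Sum>k<K. z ^ h * cnj z ^ k * (?A h k N - lim (?A h k))) / (real K)\<^sup>2"
        unfolding cesaro_block_mean_sq block_energy_def
        by (simp only: right_diff_distrib sum_subtractf minus_complex.sel diff_divide_distrib)
      have "\<bar>cesaro (\<lambda>n. (norm (block_mean c K z n))\<^sup>2) N - block_energy c K z\<bar>
          \<le> norm (\<Sum>h<K. \<Sum>k<K. z ^ h * cnj z ^ k * (?A h k N - lim (?A h k))) / (real K)\<^sup>2"
        unfolding eq abs_divide abs_power2 by (intro divide_right_mono abs_Re_le_cmod) simp
      also have "\<dots> \<le> D N"
        unfolding D_def
      proof (rule divide_right_mono, rule sum_norm_le, rule sum_norm_le)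
        fix h k
        have "norm (z ^ h * cnj z ^ k) = 1" by (simp add: norm_mult norm_power z)
        then show "norm (z ^ h * cnj z ^ k * (?A h k N - lim (?A h k))) \<le> norm (?A h k N - lim (?A h k))"
          unfolding norm_mult[of "z ^ h * cnj z ^ k"] by simp
      qed simp
      finally show ?thesis .
    qed
    with elim show ?case by (meson le_less_trans)
  qed
qed

lemma block_energy_limit:
  assumes "has_correlations c" "norm z = 1"
  shows "cesaro (\<lambda>n. (norm (block_mean c K z n))\<^sup>2) \<longlonglongrightarrow> block_energy c K z"
proof (rule tendstoI)
  fix e :: real assume "e > 0"
  from block_energy_uniform_limit[OF assms(1) this, of K]
  show "\<forall>\<^sub>F N in sequentially. dist (cesaro (\<lambda>n. (norm (block_mean c K z n))\<^sup>2) N) (block_energy c K z) < e"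
    by eventually_elim (use assms(2) in \<open>auto simp: dist_real_def\<close>)
qed

lemma block_energy_nonneg:
  assumes "has_correlations c" "norm z = 1"
  shows "0 \<le> block_energy c K z"
  by (rule LIMSEQ_le_const[OF block_energy_limit[OF assms]]) (auto simp: cesaro_def intro!: exI[of _ 0] divide_nonneg_nonneg sum_nonneg)

lemma continuous_on_block_energy [continuous_intros]:
  "continuous_on S f \<Longrightarrow> continuous_on S (\<lambda>t. block_energy c K (f t))"
  unfolding block_energy_def divide_inverse by (intro continuous_intros)

lemma norm_block_mean_le:
  assumes "\<And>n. norm (c n) \<le> C" "norm z = 1"
  shows "norm (block_mean c K z n) \<le> C"
  unfolding block_mean_def by (rule norm_cesaro_le) (simp add: norm_mult norm_power assms)

lemma block_mean_double:
  "block_mean c (2 * K) z n = (block_mean c K z n + z ^ K * block_mean c K z (n + K)) / 2"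
proof -
  have "(\<Sum>h<2*K. c (n + h) * z ^ h) = (\<Sum>h<K. c (n + h) * z ^ h) + (\<Sum>h=K..<K+K. c (n + h) * z ^ h)"
    by (simp add: lessThan_atLeast0 mult_2 sum.atLeastLessThan_concat)
  also have "(\<Sum>h=K..<K+K. c (n + h) * z ^ h) = z ^ K * (\<Sum>h<K. c (n + K + h) * z ^ h)"
    using sum.shift_bounds_nat_ivl[of "\<lambda>h. c (n + h) * z ^ h" 0 K K]
    by (simp add: lessThan_atLeast0 sum_distrib_left power_add mult_ac add_ac)
  finally show ?thesis by (simp add: block_mean_def cesaro_def add_divide_distrib mult.commute[of 2])
qed

text \<open>A block of length \<open>2 * K\<close> averages two adjacent blocks of length
  \<open>K\<close> up to a phase. Convexity of the square bounds it by the mean of the two energies,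
  which are equal because a shift does not change a Cesaro limit.\<close>

lemma block_energy_double_le:
  assumes corr: "has_correlations c" and bd: "\<And>n. norm (c n) \<le> C" and z: "norm z = 1"
  shows "block_energy c (2 * K) z \<le> block_energy c K z"
proof -
  let ?q = "\<lambda>K n. (norm (block_mean c K z n))\<^sup>2"
  have "\<bar>?q K n\<bar> \<le> C\<^sup>2" for n
    using power_mono[OF norm_block_mean_le[of c C z K n, OF bd z], of 2] by simp
  then have shift: "cesaro (\<lambda>n. ?q K (n + K)) \<longlonglongrightarrow> block_energy c K z"
    using cesaro_shift_iff[of "?q K" "C\<^sup>2" K] block_energy_limit[OF corr z] by simp
  have le: "?q (2 * K) n \<le> (1/2) * (?q K n + ?q K (n + K))" for n
  proof -
    let ?a = "norm (block_mean c K z n)" and ?b = "norm (block_mean c K z (n + K))"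
    have "norm (block_mean c (2 * K) z n) \<le> (?a + ?b) / 2"
      unfolding block_mean_double
      using norm_triangle_ineq[of "block_mean c K z n" "z ^ K * block_mean c K z (n + K)"]
      by (simp add: norm_divide norm_mult norm_power z)
    then have "?q (2 * K) n \<le> ((?a + ?b) / 2)\<^sup>2" by (intro power_mono) auto
    also have "\<dots> \<le> (1/2) * (?a\<^sup>2 + ?b\<^sup>2)"
      using zero_le_power2[of "?a - ?b"] by (simp add: power2_eq_square field_simps)
    finally show ?thesis .
  qed
  have "(\<lambda>N. (1/2) * (cesaro (?q K) N + cesaro (\<lambda>n. ?q K (n + K)) N)) \<longlonglongrightarrow> (1/2) * (block_energy c K z + block_energy c K z)"
    by (intro tendsto_intros block_energy_limit[OF corr z] shift)
  then have lim: "(\<lambda>N. (1/2) * (cesaro (?q K) N + cesaro (\<lambda>n. ?q K (n + K)) N)) \<longlonglongrightarrow> block_energy c K z"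
    by simp
  show ?thesis
  proof (rule LIMSEQ_le[OF block_energy_limit[OF corr z] lim], intro exI[of _ 0] allI impI)
    fix N
    show "cesaro (?q (2 * K)) N \<le> (1/2) * (cesaro (?q K) N + cesaro (\<lambda>n. ?q K (n + K)) N)"
      unfolding cesaro_add[symmetric] cesaro_cmult[symmetric] by (rule cesaro_mono[OF le])
  qed
qed

section \<open>Van der Corput's inequality, uniformly in the frequency\<close>

lemma norm_cesaro_square_le:
  fixes u :: "nat \<Rightarrow> complex"
  shows "(norm (cesaro u N))\<^sup>2 \<le> cesaro (\<lambda>n. (norm (u n))\<^sup>2) N"
proof (cases "N = 0")
  case False
  have "(norm (\<Sum>n<N. u n))\<^sup>2 \<le> (\<Sum>n<N. norm (u n) * 1)\<^sup>2"
    by (intro power_mono) (auto intro: norm_sum)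
  also have "\<dots> \<le> (\<Sum>n<N. (norm (u n))\<^sup>2) * (\<Sum>n<N. 1\<^sup>2)"
    by (rule Cauchy_Schwarz_ineq_sum)
  finally show ?thesis using False
    by (simp add: cesaro_def norm_divide power_divide field_simps power2_eq_square)
qed (simp add: cesaro_def)

text \<open>Restoring the phase turns block means into an average of \<open>c n * z ^ n\<close> over
  the shifts \<open>h < K\<close>; each shift changes only boundary terms of the sum over
  \<open>n < N\<close>.\<close>

lemma norm_cesaro_block_mean_diff_le:
  assumes bd: "\<And>n. norm (c n) \<le> C" and z: "norm z = 1" and K: "K > 0"
  shows "norm (cesaro (\<lambda>n. z ^ n * block_mean c K z n) N - cesaro (\<lambda>n. c n * z ^ n) N) \<le> 2 * real K * C / real N"
proof -
  let ?d = "\<lambda>n. c n * z ^ n"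
  have C: "0 \<le> C" using bd[of 0] norm_ge_zero order_trans by blast
  have *: "cesaro (\<lambda>n. z ^ n * block_mean c K z n) N - cesaro ?d N = cesaro (\<lambda>h. cesaro (\<lambda>n. ?d (n + h)) N - cesaro ?d N) K"
  proof -
    have "cesaro (\<lambda>n. z ^ n * block_mean c K z n) N = cesaro (\<lambda>h. cesaro (\<lambda>n. ?d (n + h)) N) K"
      unfolding cesaro_def block_mean_def
      by (simp add: sum_divide_distrib[symmetric] sum_distrib_left power_add mult_ac, subst sum.swap) (simp add: field_simps)
    moreover have "cesaro (\<lambda>h. cesaro ?d N) K = cesaro ?d N"
      using K by (simp add: cesaro_def)
    ultimately show ?thesis by (simp add: cesaro_diff)
  qed
  have "norm (\<Sum>h<K. cesaro (\<lambda>n. ?d (n + h)) N - cesaro ?d N) \<le> (\<Sum>h<K. 2 * real K * C / real N)"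
  proof (rule sum_norm_le)
    fix h assume "h \<in> {..<K}"
    have "norm ((\<Sum>n<N. ?d (n + h)) - (\<Sum>n<N. ?d n)) \<le> 2 * real h * C"
      by (rule norm_sum_shift_le) (simp add: norm_mult norm_power z bd)
    also have "\<dots> \<le> 2 * real K * C" using \<open>h \<in> {..<K}\<close> C by (simp add: mult_right_mono)
    finally show "norm (cesaro (\<lambda>n. ?d (n + h)) N - cesaro ?d N) \<le> 2 * real K * C / real N"
      by (simp add: cesaro_def diff_divide_distrib[symmetric] norm_divide divide_right_mono)
  qed
  then show ?thesis unfolding * using K by (simp add: cesaro_def[of _ K] norm_divide field_simps)
qed

text \<open>Up to an error of order \<open>K / N\<close>, the exponential average is an average of
  phased block means. By Cauchy-Schwarz its square is at most their mean square, which tends to the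
  block energy uniformly in \<open>z\<close>.\<close>

lemma van_der_corput_uniform:
  assumes corr: "has_correlations c" and bd: "\<And>n. norm (c n) \<le> C" and K: "K > 0" and e: "e > 0"
  shows "\<forall>\<^sub>F N in sequentially. \<forall>z. norm z = 1 \<longrightarrow>
    (norm (cesaro (\<lambda>n. c n * z ^ n) N))\<^sup>2 < block_energy c K z + e"
proof -
  have C: "0 \<le> C" using bd[of 0] norm_ge_zero order_trans by blast
  define \<delta> where "\<delta> N = 2 * real K * C / real N" for N
  have \<delta>0: "\<delta> \<longlonglongrightarrow> 0" unfolding \<delta>_def by (rule lim_const_over_n)
  \<comment> \<open>The factor \<open>2 * C\<close> comes from comparing squares: \<open>?u\<close>
    and \<open>?v\<close> below are at most \<open>C\<close>, and their squares differ by
    \<open>(?u + ?v) * (?u - ?v)\<close>.\<close>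
  have "(\<lambda>N. 2 * C * \<delta> N) \<longlonglongrightarrow> 2 * C * 0" by (intro tendsto_intros \<delta>0)
  then have "\<forall>\<^sub>F N in sequentially. 2 * C * \<delta> N < e / 2" by (rule order_tendstoD) (use e in auto)
  moreover have "\<forall>\<^sub>F N in sequentially. \<forall>z. norm z = 1 \<longrightarrow>
      \<bar>cesaro (\<lambda>n. (norm (block_mean c K z n))\<^sup>2) N - block_energy c K z\<bar> < e / 2"
    using e by (intro block_energy_uniform_limit corr) simp
  ultimately show ?thesis
  proof eventually_elim
    case (elim N)
    show ?case
    proof (intro allI impI)
      fix z :: complex assume z: "norm z = 1"
      let ?u = "norm (cesaro (\<lambda>n. c n * z ^ n) N)" and ?v = "norm (cesaro (\<lambda>n. z ^ n * block_mean c K z n) N)"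
      have u: "?u \<le> C" by (rule norm_cesaro_le) (simp add: norm_mult norm_power z bd)
      have v: "?v \<le> C"
        by (rule norm_cesaro_le) (simp add: norm_mult norm_power z norm_block_mean_le[of c C, OF bd])
      have "?u - ?v \<le> \<delta> N"
        using norm_cesaro_block_mean_diff_le[of c C z K N, OF bd z K]
          norm_triangle_ineq2[of "cesaro (\<lambda>n. c n * z ^ n) N" "cesaro (\<lambda>n. z ^ n * block_mean c K z n) N"]
        by (simp add: norm_minus_commute \<delta>_def)
      moreover have "0 \<le> \<delta> N" using C by (simp add: \<delta>_def)
      ultimately have "(?u + ?v) * (?u - ?v) \<le> (?u + ?v) * \<delta> N" by (intro mult_left_mono) auto
      also have "\<dots> \<le> (2 * C) * \<delta> N" using u v \<open>0 \<le> \<delta> N\<close> by (intro mult_right_mono) auto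
      finally have "?u\<^sup>2 \<le> ?v\<^sup>2 + 2 * C * \<delta> N" by (simp add: power2_eq_square algebra_simps)
      moreover have "?v\<^sup>2 \<le> cesaro (\<lambda>n. (norm (z ^ n * block_mean c K z n))\<^sup>2) N" by (rule norm_cesaro_square_le)
      moreover have "cesaro (\<lambda>n. (norm (z ^ n * block_mean c K z n))\<^sup>2) N = cesaro (\<lambda>n. (norm (block_mean c K z n))\<^sup>2) N"
        by (simp add: norm_mult norm_power z)
      moreover have "\<bar>cesaro (\<lambda>n. (norm (block_mean c K z n))\<^sup>2) N - block_energy c K z\<bar> < e / 2"
        using elim(2) z by blast
      ultimately show "?u\<^sup>2 < block_energy c K z + e" using elim(1) by linarith
    qed
  qed
qed

lemma norm_twisted_limit_le:
  assumes corr: "has_correlations c" and bd: "\<And>n. norm (c n) \<le> C" and K: "K > 0" and z: "norm z = 1"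
    and b: "cesaro (\<lambda>n. c n * z ^ n) \<longlonglongrightarrow> b"
  shows "(norm b)\<^sup>2 \<le> block_energy c K z"
proof (rule field_le_epsilon)
  fix e :: real assume e: "e > 0"
  show "(norm b)\<^sup>2 \<le> block_energy c K z + e"
  proof (rule tendsto_upperbound)
    show "(\<lambda>N. (norm (cesaro (\<lambda>n. c n * z ^ n) N))\<^sup>2) \<longlonglongrightarrow> (norm b)\<^sup>2"
      by (intro tendsto_intros b)
    show "\<forall>\<^sub>F N in sequentially. (norm (cesaro (\<lambda>n. c n * z ^ n) N))\<^sup>2 \<le> block_energy c K z + e"
      using van_der_corput_uniform[OF corr bd K e] by eventually_elim (use z in \<open>auto intro: less_imp_le\<close>)
  qed simp
qed

text \<open>Pythagoras for the mean-square seminorm: \<open>b\<close> is the Fourier coefficient of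
  \<open>c\<close> along \<open>cnj z ^ n\<close>, so the remainder is orthogonal to the exponential
  that is subtracted.\<close>

lemma energy_remove_frequency:
  fixes c :: "nat \<Rightarrow> complex"
  assumes z: "norm z = 1" and b: "cesaro (\<lambda>n. c n * z ^ n) \<longlonglongrightarrow> b"
    and E: "cesaro (\<lambda>n. (norm (c n))\<^sup>2) \<longlonglongrightarrow> E"
  shows "cesaro (\<lambda>n. (norm (c n - b * cnj z ^ n))\<^sup>2) \<longlonglongrightarrow> E - (norm b)\<^sup>2"
proof -
  have zz: "z ^ n * cnj z ^ n = 1" for n
  proof -
    have "z * cnj z = 1" using complex_norm_square[of z] z by simp
    then show ?thesis by (metis power_mult_distrib power_one)
  qed
  have sq: "(norm (c n - b * cnj z ^ n))\<^sup>2 = ((norm (c n))\<^sup>2 + (norm b)\<^sup>2) - 2 * Re (cnj b * (c n * z ^ n))" for n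
  proof -
    have "complex_of_real ((norm (c n - b * cnj z ^ n))\<^sup>2) = (c n - b * cnj z ^ n) * (cnj (c n) - cnj b * z ^ n)"
      unfolding complex_norm_square by simp
    also have "\<dots> = c n * cnj (c n) + b * cnj b * (z ^ n * cnj z ^ n) - (cnj b * (c n * z ^ n) + cnj (cnj b * (c n * z ^ n)))"
      by (simp add: algebra_simps)
    also have "\<dots> = complex_of_real (((norm (c n))\<^sup>2 + (norm b)\<^sup>2) - 2 * Re (cnj b * (c n * z ^ n)))"
      unfolding zz complex_add_cnj by (simp add: complex_norm_square del: of_real_power)
    finally show ?thesis by (simp only: of_real_eq_iff)
  qed
  have ces: "cesaro (\<lambda>n. (norm (c n - b * cnj z ^ n))\<^sup>2) N =
      cesaro (\<lambda>n. (norm (c n))\<^sup>2) N + cesaro (\<lambda>n. (norm b)\<^sup>2) N - 2 * Re (cnj b * cesaro (\<lambda>n. c n * z ^ n) N)" for N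
    unfolding sq cesaro_diff cesaro_add cesaro_cmult[symmetric]
    by (simp only: cesaro_cmult) (simp add: cesaro_def sum_distrib_left sum_divide_distrib)
  have const: "cesaro (\<lambda>n. (norm b)\<^sup>2) \<longlonglongrightarrow> (norm b)\<^sup>2"
    by (rule tendsto_eventually, rule eventually_sequentiallyI[of 1]) (simp add: cesaro_def)
  have "(\<lambda>N. cesaro (\<lambda>n. (norm (c n))\<^sup>2) N + cesaro (\<lambda>n. (norm b)\<^sup>2) N - 2 * Re (cnj b * cesaro (\<lambda>n. c n * z ^ n) N))
      \<longlonglongrightarrow> E + (norm b)\<^sup>2 - 2 * Re (cnj b * b)"
    by (intro tendsto_intros E b const)
  moreover have "Re (cnj b * b) = (norm b)\<^sup>2"
    by (metis Re_complex_of_real complex_norm_square mult.commute)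
  ultimately have "(\<lambda>N. cesaro (\<lambda>n. (norm (c n))\<^sup>2) N + cesaro (\<lambda>n. (norm b)\<^sup>2) N - 2 * Re (cnj b * cesaro (\<lambda>n. c n * z ^ n) N))
      \<longlonglongrightarrow> E + (norm b)\<^sup>2 - 2 * (norm b)\<^sup>2" by (simp only:)
  moreover have "E + (norm b)\<^sup>2 - 2 * (norm b)\<^sup>2 = E - (norm b)\<^sup>2" by simp
  ultimately show ?thesis unfolding ces by (simp only:)
qed

section \<open>Measurable selection of a maximiser\<close>

text \<open>The superlevel sets are nonempty, compact and nested, hence have a common point.\<close>

lemma decseq_continuous_common_point:
  fixes f :: "nat \<Rightarrow> real \<Rightarrow> real"
  assumes cont: "\<And>k. continuous_on {0..s} (f k)" and dec: "\<And>k t. f (Suc k) t \<le> f k t"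
    and ex: "\<And>k. \<exists>t\<in>{0..s}. m \<le> f k t"
  shows "\<exists>t\<in>{0..s}. \<forall>k. m \<le> f k t"
proof -
  define A where "A k = {t \<in> {0..s}. m \<le> f k t}" for k
  have "compact (A k)" for k
  proof -
    have "closed (A k)"
      unfolding A_def by (intro continuous_on_closed_Collect_le cont continuous_intros closed_atLeastAtMost)
    moreover have "A k \<subseteq> {0..s}" by (auto simp: A_def)
    ultimately show ?thesis by (meson bounded_closed_interval bounded_subset compact_eq_bounded_closed)
  qed
  moreover have "A k \<noteq> {}" for k using ex[of k] by (auto simp: A_def)
  moreover have "A n \<subseteq> A k" if "k \<le> n" for k n
    using lift_Suc_antimono_le[of "\<lambda>k. f k t" for t, OF dec that] by (auto simp: A_def intro: order_trans)
  ultimately have "(\<Inter>k. A k) \<noteq> {}" by (intro compact_nest) auto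
  then obtain t where "\<And>k. t \<in> A k" by blast
  then show ?thesis unfolding A_def by blast
qed

text \<open>Writing a maximum over \<open>{0..s}\<close> as a countable supremum keeps it measurable
  in a parameter. The points \<open>r * s\<close> provide one index set that serves every
  \<open>s\<close>, including \<open>s = 0\<close>.\<close>

lemma SUP_rational_multiples:
  fixes f :: "real \<Rightarrow> real"
  assumes cont: "continuous_on {0..s} f" and s: "0 \<le> s"
  defines "S \<equiv> (SUP r\<in>\<rat> \<inter> {0..1}. f (r * s))"
  shows "bdd_above ((\<lambda>r. f (r * s)) ` (\<rat> \<inter> {0..1}))" "\<And>t. t \<in> {0..s} \<Longrightarrow> f t \<le> S" "\<exists>t\<in>{0..s}. f t = S"
proof -
  obtain m where m: "m \<in> {0..s}" "\<And>t. t \<in> {0..s} \<Longrightarrow> f t \<le> f m"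
    using continuous_attains_sup[of "{0..s}" f] cont s by auto
  have in_range: "r * s \<in> {0..s}" if "r \<in> {0..1}" for r
    using that s by (auto intro: mult_left_le_one_le)
  show bdd: "bdd_above ((\<lambda>r. f (r * s)) ` (\<rat> \<inter> {0..1}))"
    by (rule bdd_aboveI[of _ "f m"]) (use m in_range in auto)
  show le: "f t \<le> S" if t: "t \<in> {0..s}" for t
  proof -
    define h where "h r = f (r * s)" for r
    have h: "continuous_on {0..1} h"
      unfolding h_def by (rule continuous_on_compose2[OF cont]) (use in_range in \<open>auto intro!: continuous_intros\<close>)
    have dense: "{0..1::real} \<subseteq> closure (\<rat> \<inter> {0<..<1})"
    proof -
      have "closure ({0<..<1} \<inter> \<rat>) = closure {0<..<1::real}"
        by (rule closure_open_Int_superset) (auto simp: Rats_closure_real)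
      then show ?thesis by (simp add: Int_commute)
    qed
    have "h ` {0..1} \<subseteq> {..S}"
    proof (rule order_trans)
      have "closure (\<rat> \<inter> {0<..<1::real}) \<subseteq> closure {0<..<1}" by (rule closure_mono) auto
      then have eq: "closure (\<rat> \<inter> {0<..<1::real}) = {0..1}" using dense by auto
      show "h ` {0..1} \<subseteq> h ` closure (\<rat> \<inter> {0<..<1})" by (simp add: eq)
      show "h ` closure (\<rat> \<inter> {0<..<1}) \<subseteq> {..S}"
      proof (rule image_closure_subset)
        show "continuous_on (closure (\<rat> \<inter> {0<..<1})) h" using h by (simp add: eq)
        show "h ` (\<rat> \<inter> {0<..<1}) \<subseteq> {..S}"
          unfolding S_def h_def by (auto intro!: cSUP_upper bdd)
      qed simp
    qed
    moreover have "f t = h (t / s)" "t / s \<in> {0..1}" if "s \<noteq> 0"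
      using that t s by (auto simp: h_def field_simps)
    moreover have "f t = h 0" if "s = 0" using that t by (simp add: h_def)
    ultimately show ?thesis by (cases "s = 0") (auto simp: image_subset_iff)
  qed
  have "S \<le> f m"
    unfolding S_def by (rule cSUP_least) (use m in_range in auto)
  then show "\<exists>t\<in>{0..s}. f t = S" using m(1) le[OF m(1)] by (intro bexI[of _ m]) auto
qed

text \<open>The selected point maximises the decreasing limit of the functions \<open>F k x\<close>.
  The second clause says so without naming that limit: a level reached somewhere for each
  \<open>k\<close> is reached for all \<open>k\<close> at \<open>\<theta> x\<close>. The third
  clause, that the choice depends on \<open>x\<close> only through these functions, turns invariance
  of \<open>F\<close> into invariance of \<open>\<theta>\<close>.\<close>

lemma measurable_common_argmax:
  fixes F :: "nat \<Rightarrow> 'a \<Rightarrow> real \<Rightarrow> real"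
  assumes meas [measurable]: "\<And>k t. (\<lambda>x. F k x t) \<in> borel_measurable M"
    and cont: "\<And>k x. continuous_on UNIV (F k x)"
    and dec: "\<And>k x t. F (Suc k) x t \<le> F k x t"
    and nonneg: "\<And>k x t. 0 \<le> F k x t"
  shows "\<exists>\<theta>. \<theta> \<in> borel_measurable M
    \<and> (\<forall>x m k. (\<forall>k. \<exists>t\<in>{0..1}. m \<le> F k x t) \<longrightarrow> m \<le> F k x (\<theta> x))
    \<and> (\<forall>x y. (\<forall>k t. F k x t = F k y t) \<longrightarrow> \<theta> x = \<theta> y)"
proof -
  define S where "S k x s = (SUP r\<in>\<rat> \<inter> {0..1}. F k x (r * s))" for k x s
  have cont': "continuous_on A (F k x)" for A k x
    using cont continuous_on_subset by blast
  have bdd: "bdd_above ((\<lambda>r. F k x (r * s)) ` (\<rat> \<inter> {0..1}))"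
    and S_ge: "\<And>t. t \<in> {0..s} \<Longrightarrow> F k x t \<le> S k x s"
    and S_ex: "\<exists>t\<in>{0..s}. F k x t = S k x s" if "0 \<le> s" for k x s
    using SUP_rational_multiples[where f = "F k x", OF cont' that] unfolding S_def by auto
  \<comment> \<open>By compactness this infimum of maxima is attained: it is the maximum over
    \<open>{0..1}\<close> of the decreasing limit.\<close>
  define m where "m x = (INF k. S k x 1)" for x
  have S_nonneg: "0 \<le> S k x 1" for k x
    using S_ge[of 1 0 k x] nonneg[of k x 0] by auto
  have bdd_m: "bdd_below (range (\<lambda>k. S k x 1))" for x
    by (rule bdd_belowI[of _ 0]) (use S_nonneg in auto)
  have S_meas [measurable]: "(\<lambda>x. S k x s) \<in> borel_measurable M" if "0 \<le> s" for k s
    unfolding S_def by (rule borel_measurable_cSUP) (use bdd[OF that] countable_rat in \<open>auto\<close>)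
  have m_meas [measurable]: "m \<in> borel_measurable M"
    unfolding m_def by (rule borel_measurable_cINF) (use bdd_m S_meas in auto)
  define E where "E x = {t \<in> {0..1}. \<forall>k. m x \<le> F k x t}" for x
  \<comment> \<open>Compactness trades a point common to all \<open>k\<close> for one inequality per
    \<open>k\<close>, which is a countable family of measurable conditions on
    \<open>x\<close>.\<close>
  have E_iff: "(\<exists>t\<in>E x. t \<le> s) \<longleftrightarrow> (\<forall>k. m x \<le> S k x s)" if s: "0 \<le> s" "s \<le> 1" for x s
  proof
    assume "\<exists>t\<in>E x. t \<le> s"
    then show "\<forall>k. m x \<le> S k x s"
      using S_ge[OF s(1)] by (auto simp: E_def) (meson order_trans)
  next
    assume *: "\<forall>k. m x \<le> S k x s"
    have "\<exists>t\<in>{0..s}. \<forall>k. m x \<le> F k x t"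
      by (rule decseq_continuous_common_point[where f = "\<lambda>k. F k x", OF cont' dec]) (use * S_ex[OF s(1)] in metis)
    then show "\<exists>t\<in>E x. t \<le> s" using s by (auto simp: E_def)
  qed
  have E_ne: "E x \<noteq> {}" for x
    using E_iff[of 1 x] cINF_lower[OF bdd_m, of _ x] by (auto simp: m_def)
  have E_closed: "closed (E x)" for x
  proof -
    have "E x = {0..1} \<inter> (\<Inter>k. {t. m x \<le> F k x t})" by (auto simp: E_def)
    also have "closed \<dots>"
      by (intro closed_Int closed_INT ballI closed_Collect_le cont' continuous_intros closed_atLeastAtMost)
    finally show ?thesis .
  qed
  have E_bdd: "bdd_below (E x)" for x by (rule bdd_belowI[of _ 0]) (auto simp: E_def)
  \<comment> \<open>The least maximiser; \<open>E_iff\<close> makes its sublevel sets measurable.\<close>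
  define \<theta> where "\<theta> x = Inf (E x)" for x
  have \<theta>_in: "\<theta> x \<in> E x" for x
    unfolding \<theta>_def by (rule closed_contains_Inf[OF E_ne E_bdd E_closed])
  have \<theta>_01: "0 \<le> \<theta> x \<and> \<theta> x \<le> 1" for x using \<theta>_in[of x] by (simp add: E_def)
  have \<theta>_le: "\<theta> x \<le> s \<longleftrightarrow> (\<exists>t\<in>E x. t \<le> s)" for x s
    using \<theta>_in[of x] cInf_lower[OF _ E_bdd[of x]] unfolding \<theta>_def by (meson order_trans)
  show ?thesis
  proof (intro exI[of _ \<theta>] conjI allI impI)
    show "\<theta> \<in> borel_measurable M"
    proof (rule borel_measurable_iff_le[THEN iffD2], intro allI)
      fix s :: real
      consider "s < 0" | "1 < s" | "0 \<le> s" "s \<le> 1" by linarith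
      then show "{x \<in> space M. \<theta> x \<le> s} \<in> sets M"
      proof cases
        case 1
        then have "{x \<in> space M. \<theta> x \<le> s} = {}" using \<theta>_01 by (auto simp: not_le intro: less_le_trans)
        then show ?thesis by (simp only: sets.empty_sets)
      next
        case 2
        then have "{x \<in> space M. \<theta> x \<le> s} = space M" using \<theta>_01 by (auto intro: order_trans[OF _ less_imp_le])
        then show ?thesis by (simp only: sets.top)
      next
        case 3
        note S_meas[OF 3(1), measurable]
        have "{x \<in> space M. \<theta> x \<le> s} = {x \<in> space M. \<forall>k. m x \<le> S k x s}"
          unfolding \<theta>_le E_iff[OF 3] ..
        also have "\<dots> \<in> sets M" by measurable
        finally show ?thesis .
      qed
    qed
    show "l \<le> F k x (\<theta> x)" if "\<forall>k. \<exists>t\<in>{0..1}. l \<le> F k x t" for x l k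
    proof -
      have "l \<le> m x"
        unfolding m_def
      proof (rule cINF_greatest)
        fix k
        show "l \<le> S k x 1" using spec[OF that, of k] S_ge[of 1 _ k x] by fastforce
      qed simp
      then show ?thesis using \<theta>_in[of x] by (auto simp: E_def intro: order_trans)
    qed
    show "\<theta> x = \<theta> y" if "\<forall>k t. F k x t = F k y t" for x y
      by (simp add: \<theta>_def E_def m_def S_def that)
  qed
qed

section \<open>The dominant frequency of an orbit\<close>

text \<open>\<open>lim\<close> is a description of the limit, so two sequences with the same set of
  limits get the same value even if that set is empty.\<close>

lemma lim_convergent_cong:
  assumes "\<And>L. X \<longlonglongrightarrow> L \<longleftrightarrow> Y \<longlonglongrightarrow> L"
  shows "lim X = lim Y" "convergent X = convergent Y"
  using assms by (auto simp: lim_def convergent_def)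

lemma cis_surj_unit_interval:
  assumes "norm w = 1"
  shows "\<exists>t\<in>{0..1}. w = cis (2 * pi * t)"
proof -
  have "w = cis (Arg w)" using cis_Arg[of w] assms by (force simp: sgn_eq)
  also have "\<dots> = cis (2 * pi * (Arg w / (2 * pi)))" by simp
  also have "\<dots> = cis (2 * pi * frac (Arg w / (2 * pi)))" by (rule cis_2pi_frac[symmetric])
  finally show ?thesis using frac_lt_1[of "Arg w / (2 * pi)"] by (intro bexI[of _ "frac (Arg w / (2 * pi))"]) auto
qed

context mpt
begin

definition orbit :: "('a \<Rightarrow> complex) \<Rightarrow> 'a \<Rightarrow> nat \<Rightarrow> complex" where
  "orbit g x n = g ((T ^^ n) x)"

lemma measurable_orbit [measurable]:
  assumes [measurable]: "g \<in> borel_measurable M"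
  shows "(\<lambda>x. orbit g x n) \<in> borel_measurable M"
  unfolding orbit_def by measurable

lemma orbit_T_pow: "orbit g ((T ^^ m) x) n = orbit g x (n + m)"
  by (simp add: orbit_def funpow_add)

lemma orbit_T: "orbit g (T x) n = orbit g x (n + 1)"
  using orbit_T_pow[of g 1] by simp

text \<open>Birkhoff's theorem for the products
  \<open>g ((T ^^ h) x) * cnj (g ((T ^^ k) x))\<close>, of which there are countably many.\<close>

lemma AE_has_correlations:
  assumes [measurable]: "g \<in> borel_measurable M" and bd: "\<And>x. x \<in> space M \<Longrightarrow> norm (g x) \<le> C"
  shows "AE x in M. has_correlations (orbit g x)"
  unfolding has_correlations_def
proof (subst AE_all_countable, rule allI, subst AE_all_countable, rule allI)
  fix h k
  let ?f = "\<lambda>x. orbit g x h * cnj (orbit g x k)"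
  have "AE x in M. convergent (cesaro (\<lambda>n. ?f ((T ^^ n) x)))"
  proof (rule birkhoff[where C = "C * C"])
    show "norm (?f x) \<le> C * C" if "x \<in> space M" for x
      using that bd[of "(T ^^ h) x"] bd[of "(T ^^ k) x"] order_trans[OF norm_ge_zero bd[OF that]]
      by (auto simp: orbit_def norm_mult intro!: mult_mono)
  qed measurable
  then show "AE x in M. convergent (cesaro (\<lambda>n. orbit g x (n + h) * cnj (orbit g x (n + k))))"
    by (simp add: orbit_T_pow add.commute)
qed

text \<open>Moving from \<open>x\<close> to \<open>T x\<close> shifts the orbit by one, which leaves
  all Cesaro limits unchanged. This is the source of the invariance of the selected
  frequency.\<close>

lemma correlations_invariant:
  assumes bd: "\<And>x. x \<in> space M \<Longrightarrow> norm (g x) \<le> C" and x: "x \<in> space M"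
  shows "has_correlations (orbit g (T x)) \<longleftrightarrow> has_correlations (orbit g x)"
    "block_energy (orbit g (T x)) K z = block_energy (orbit g x) K z"
proof -
  let ?X = "\<lambda>x h k. cesaro (\<lambda>n. orbit g x (n + h) * cnj (orbit g x (n + k)))"
  have *: "?X (T x) h k \<longlonglongrightarrow> L \<longleftrightarrow> ?X x h k \<longlonglongrightarrow> L" for h k L
  proof -
    have "norm (orbit g x (n + h) * cnj (orbit g x (n + k))) \<le> C * C" for n
      using x bd[of "(T ^^ (n + h)) x"] bd[of "(T ^^ (n + k)) x"] order_trans[OF norm_ge_zero bd[OF x]]
      by (auto simp: orbit_def norm_mult intro!: mult_mono)
    then show ?thesis
      using cesaro_shift_iff[of "\<lambda>n. orbit g x (n + h) * cnj (orbit g x (n + k))" "C * C" 1 L]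
      by (simp add: orbit_T)
  qed
  show "has_correlations (orbit g (T x)) \<longleftrightarrow> has_correlations (orbit g x)"
    unfolding has_correlations_def using lim_convergent_cong(2)[OF *] by simp
  show "block_energy (orbit g (T x)) K z = block_energy (orbit g x) K z"
    unfolding block_energy_def using lim_convergent_cong(1)[OF *] by simp
qed

section \<open>Measurable choice of the maximal frequency and its energy\<close>

lemma measurable_has_correlations [measurable]:
  assumes [measurable]: "g \<in> borel_measurable M"
  shows "Measurable.pred M (\<lambda>x. has_correlations (orbit g x))"
proof -
  have "{x \<in> space M. Cauchy (\<lambda>N. cesaro (\<lambda>n. orbit g x (n + h) * cnj (orbit g x (n + k))) N)} \<in> sets M" for h k
    unfolding cesaro_def by (rule sets_Collect_Cauchy) measurable
  then have [measurable]: "Measurable.pred M (\<lambda>x. convergent (cesaro (\<lambda>n. orbit g x (n + h) * cnj (orbit g x (n + k)))))" for h k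
    by (simp add: pred_def Cauchy_convergent_iff)
  show ?thesis unfolding has_correlations_def by measurable
qed

lemma measurable_block_energy [measurable]:
  assumes [measurable]: "g \<in> borel_measurable M" "z \<in> borel_measurable M"
  shows "(\<lambda>x. block_energy (orbit g x) K (z x)) \<in> borel_measurable M"
proof -
  have [measurable]: "(\<lambda>x. lim (\<lambda>N. cesaro (\<lambda>n. orbit g x (n + h) * cnj (orbit g x (n + k))) N)) \<in> borel_measurable M" for h k
    unfolding cesaro_def by (rule borel_measurable_lim_metric) measurable
  show ?thesis unfolding block_energy_def by measurable
qed

text \<open>Block energies decrease along lengths \<open>2 ^ k\<close>, so their limit has a
  measurable maximiser. Maximality appears in contrapositive form: a bound at the chosen frequency
  for one block length yields the same bound at all frequencies for some, possibly longer, block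
  length.\<close>

lemma exists_maximal_frequency:
  assumes [measurable]: "g \<in> borel_measurable M" and bd: "\<And>x. x \<in> space M \<Longrightarrow> norm (g x) \<le> C"
  obtains \<theta> where "\<theta> \<in> borel_measurable M" "\<And>x. x \<in> space M \<Longrightarrow> \<theta> (T x) = \<theta> x"
    "\<And>x e k. \<lbrakk>x \<in> space M; has_correlations (orbit g x);
      block_energy (orbit g x) (2 ^ k) (cis (2 * pi * \<theta> x)) < e\<rbrakk>
      \<Longrightarrow> \<exists>K>0. \<forall>w. norm w = 1 \<longrightarrow> block_energy (orbit g x) K w < e"
proof -
  \<comment> \<open>The value 0 at exceptional points makes monotonicity, continuity and
    nonnegativity hold for every \<open>x\<close>, as the selection requires.\<close>
  define F where "F k x t = (if x \<in> space M \<and> has_correlations (orbit g x)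
    then block_energy (orbit g x) (2 ^ k) (cis (2 * pi * t)) else 0)" for k x t
  have o_bd: "norm (orbit g x n) \<le> C" if "x \<in> space M" for x n
    using that bd by (simp add: orbit_def)
  have "\<exists>\<theta>. \<theta> \<in> borel_measurable M
    \<and> (\<forall>x m k. (\<forall>k. \<exists>t\<in>{0..1}. m \<le> F k x t) \<longrightarrow> m \<le> F k x (\<theta> x))
    \<and> (\<forall>x y. (\<forall>k t. F k x t = F k y t) \<longrightarrow> \<theta> x = \<theta> y)"
  proof (rule measurable_common_argmax)
    show "(\<lambda>x. F k x t) \<in> borel_measurable M" for k t
      unfolding F_def by measurable
    show "continuous_on UNIV (F k x)" for k x
      unfolding F_def
      by (cases "x \<in> space M \<and> has_correlations (orbit g x)") (auto intro!: continuous_intros)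
    show "F (Suc k) x t \<le> F k x t" for k x t
      unfolding F_def using block_energy_double_le[of "orbit g x" C "cis (2 * pi * t)" "2 ^ k"] o_bd by auto
    show "0 \<le> F k x t" for k x t
      unfolding F_def by (auto intro: block_energy_nonneg)
  qed
  then obtain \<theta> where \<theta>: "\<theta> \<in> borel_measurable M"
      "\<And>x m k. (\<forall>k. \<exists>t\<in>{0..1}. m \<le> F k x t) \<Longrightarrow> m \<le> F k x (\<theta> x)"
      "\<And>x y. (\<forall>k t. F k x t = F k y t) \<Longrightarrow> \<theta> x = \<theta> y"
    by blast
  show thesis
  proof
    show "\<theta> \<in> borel_measurable M" by fact
    show "\<theta> (T x) = \<theta> x" if "x \<in> space M" for x
      by (rule \<theta>(3)) (use correlations_invariant[of g C, OF bd that] that in \<open>simp add: F_def\<close>)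
    fix x e k
    assume x: "x \<in> space M" "has_correlations (orbit g x)"
      and e: "block_energy (orbit g x) (2 ^ k) (cis (2 * pi * \<theta> x)) < e"
    \<comment> \<open>If every \<open>F k x\<close> reached the level \<open>e\<close> somewhere,
      maximality would force the value at \<open>\<theta> x\<close> up to \<open>e\<close> as
      well.\<close>
    have "\<not> (\<forall>k. \<exists>t\<in>{0..1}. e \<le> F k x t)"
      using \<theta>(2)[of e x k] e x by (auto simp: F_def)
    then obtain k' where k': "\<And>t. t \<in> {0..1} \<Longrightarrow> F k' x t < e" by (meson not_le)
    show "\<exists>K>0. \<forall>w. norm w = 1 \<longrightarrow> block_energy (orbit g x) K w < e"
    proof (intro exI[of _ "2 ^ k'"] conjI allI impI)
      fix w :: complex assume "norm w = 1"
      then obtain t where "t \<in> {0..1}" "w = cis (2 * pi * t)" using cis_surj_unit_interval by blast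
      then show "block_energy (orbit g x) (2 ^ k') w < e" using k'[of t] x by (simp add: F_def)
    qed simp
  qed
qed

text \<open>At an invariant frequency van der Corput's bound becomes an equality in the limit. For
  each \<open>k\<close> the energy of length \<open>2 ^ k\<close> and the squared twisted average of
  that length from \<open>x\<close> have the same integral; letting \<open>k\<close> grow, the limit
  energy and the squared limit average have the same integral, and the pointwise inequality between
  them must be an equality almost everywhere.\<close>

lemma AE_twisted_limit_energy:
  assumes [measurable]: "g \<in> borel_measurable M" "\<theta> \<in> borel_measurable M"
    and bd: "\<And>x. x \<in> space M \<Longrightarrow> norm (g x) \<le> C"
    and inv: "\<And>x. x \<in> space M \<Longrightarrow> \<theta> (T x) = \<theta> x"
  defines "z \<equiv> \<lambda>x. cis (2 * pi * \<theta> x)"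
  shows "AE x in M. (\<lambda>k. block_energy (orbit g x) (2 ^ k) (z x)) \<longlonglongrightarrow>
    (norm (lim (cesaro (\<lambda>n. orbit g x n * z x ^ n))))\<^sup>2"
proof -
  have [measurable]: "z \<in> borel_measurable M" unfolding z_def by measurable
  have nz: "norm (z x) = 1" for x by (simp add: z_def)
  have z_inv: "z ((T ^^ n) x) = z x" if "x \<in> space M" for x n
    by (induction n) (use that inv in \<open>auto simp: z_def\<close>)
  have o_bd: "norm (orbit g x n) \<le> C" if "x \<in> space M" for x n
    using that bd by (simp add: orbit_def)
  define B where "B x = (norm (lim (cesaro (\<lambda>n. orbit g x n * z x ^ n))))\<^sup>2" for x
  define w where "w k x = block_energy (orbit g x) (2 ^ k) (z x)" for k x
  define u where "u k x = (norm (block_mean (orbit g x) (2 ^ k) (z x) 0))\<^sup>2" for k x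
  have [measurable]: "B \<in> borel_measurable M" unfolding B_def cesaro_def by measurable
  have [measurable]: "w k \<in> borel_measurable M" for k unfolding w_def by measurable
  have u_meas [measurable]: "u k \<in> borel_measurable M" for k unfolding u_def block_mean_def cesaro_def by measurable
  have u_T: "u k ((T ^^ n) x) = (norm (block_mean (orbit g x) (2 ^ k) (z x) n))\<^sup>2" if "x \<in> space M" for k n x
    by (simp add: u_def block_mean_def orbit_T_pow z_inv[OF that] add.commute)
  have bm_bd: "(norm (block_mean (orbit g x) (2 ^ k) (z x) n))\<^sup>2 \<le> C\<^sup>2" if "x \<in> space M" for k n x
    by (intro power_mono norm_block_mean_le nz) (use o_bd[OF that] in auto)
  have u_bd: "\<bar>u k x\<bar> \<le> C\<^sup>2" if "x \<in> space M" for k x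
    using bm_bd[OF that, of k 0] by (simp add: u_def)
  have corr: "AE x in M. has_correlations (orbit g x)"
    by (rule AE_has_correlations) (use bd in auto)
  have conv: "AE x in M. cesaro (\<lambda>n. orbit g x n * z x ^ n) \<longlonglongrightarrow> lim (cesaro (\<lambda>n. orbit g x n * z x ^ n))"
    using birkhoff_twisted[of g \<theta> C] bd inv by (simp add: orbit_def z_def convergent_LIMSEQ_iff)
  \<comment> \<open>\<open>B \<le> lim w\<close> holds pointwise, and both sides have the same integral.\<close>
  have int_u: "(\<integral>x. u k x \<partial>M) = (\<integral>x. w k x \<partial>M)" for k
  proof -
    let ?c = "\<lambda>N x. cesaro (\<lambda>n. u k ((T ^^ n) x)) N"
    \<comment> \<open>Averaging \<open>u k\<close> along the orbit keeps its integral, since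
      \<open>T\<close> preserves the measure, and converges pointwise to the energy
      \<open>w k\<close>.\<close>
    have "(\<lambda>N. \<integral>x. ?c N x \<partial>M) \<longlonglongrightarrow> (\<integral>x. w k x \<partial>M)"
    proof (rule integral_dominated_convergence[where w = "\<lambda>_. C\<^sup>2"])
      show "?c N \<in> borel_measurable M" for N unfolding cesaro_def by measurable
      show "AE x in M. (\<lambda>N. ?c N x) \<longlonglongrightarrow> w k x"
        using corr
      proof (rule AE_mp, intro AE_I2 impI)
        fix x assume x: "x \<in> space M" and "has_correlations (orbit g x)"
        then show "(\<lambda>N. ?c N x) \<longlonglongrightarrow> w k x"
          using block_energy_limit[OF _ nz, of "orbit g x" "2 ^ k" x] by (simp add: u_T w_def)
      qed
      show "AE x in M. norm (?c N x) \<le> C\<^sup>2" for N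
        by (intro AE_I2 norm_cesaro_le) (simp add: u_bd)
    qed auto
    moreover have "(\<integral>x. ?c N x \<partial>M) = (\<integral>x. u k x \<partial>M)" if "N \<ge> 1" for N
    proof -
      have "integrable M (\<lambda>x. u k ((T ^^ n) x))" for n
        by (rule integrable_const_bound[of _ "C\<^sup>2"]) (auto simp: u_bd)
      then have "(\<integral>x. ?c N x \<partial>M) = cesaro (\<lambda>n. \<integral>x. u k ((T ^^ n) x) \<partial>M) N"
        unfolding cesaro_def by (simp add: Bochner_Integration.integral_sum)
      also have "\<dots> = (\<integral>x. u k x \<partial>M)" using that by (simp add: integral_T_pow cesaro_def)
      finally show ?thesis .
    qed
    then have "(\<lambda>N. \<integral>x. ?c N x \<partial>M) \<longlonglongrightarrow> (\<integral>x. u k x \<partial>M)"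
      by (intro tendsto_eventually eventually_sequentiallyI[of 1])
    ultimately show ?thesis using LIMSEQ_unique by blast
  qed
  have dec: "w (Suc k) x \<le> w k x" if "x \<in> space M" "has_correlations (orbit g x)" for k x
    unfolding w_def using block_energy_double_le[OF that(2) o_bd[OF that(1)] nz, of "2 ^ k"] by simp
  have w_nonneg: "0 \<le> w k x" if "has_correlations (orbit g x)" for k x
    unfolding w_def by (rule block_energy_nonneg[OF that nz])
  have w_bd: "w k x \<le> C\<^sup>2" if "x \<in> space M" "has_correlations (orbit g x)" for k x
    unfolding w_def
    by (rule LIMSEQ_le_const2[OF block_energy_limit[OF that(2) nz]], intro exI[of _ 0] allI impI)
       (use norm_cesaro_le[of "\<lambda>n. (norm (block_mean (orbit g x) (2 ^ k) (z x) n))\<^sup>2" "C\<^sup>2"] bm_bd[OF that(1)] in \<open>simp add: abs_le_iff\<close>)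
  have w_lim: "(\<lambda>k. w k x) \<longlonglongrightarrow> lim (\<lambda>k. w k x)" if "x \<in> space M" "has_correlations (orbit g x)" for x
  proof -
    have "decseq (\<lambda>k. w k x)" using dec[OF that] by (rule decseq_SucI)
    then have "convergent (\<lambda>k. w k x)"
      using decseq_convergent[of "\<lambda>k. w k x" 0] w_nonneg[OF that(2)] by (metis convergent_def)
    then show ?thesis by (simp add: convergent_LIMSEQ_iff)
  qed
  have "(\<lambda>k. \<integral>x. u k x \<partial>M) \<longlonglongrightarrow> (\<integral>x. B x \<partial>M)"
  proof (rule integral_dominated_convergence[where w = "\<lambda>_. C\<^sup>2"])
    show "AE x in M. (\<lambda>k. u k x) \<longlonglongrightarrow> B x"
      using conv
    proof eventually_elim
      case (elim x)
      have "(\<lambda>N. (norm (cesaro (\<lambda>n. orbit g x n * z x ^ n) N))\<^sup>2) \<longlonglongrightarrow> B x"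
        unfolding B_def by (intro tendsto_intros elim)
      \<comment> \<open>The block mean at position 0 is the twisted average itself, here sampled at
        \<open>N = 2 ^ k\<close>.\<close>
      then have "((\<lambda>N. (norm (cesaro (\<lambda>n. orbit g x n * z x ^ n) N))\<^sup>2) \<circ> (\<lambda>k. 2 ^ k)) \<longlonglongrightarrow> B x"
        by (rule LIMSEQ_subseq_LIMSEQ) (simp add: strict_mono_def)
      then show ?case by (simp add: u_def block_mean_def comp_def)
    qed
  qed (auto simp: u_bd)
  moreover have "(\<lambda>k. \<integral>x. w k x \<partial>M) \<longlonglongrightarrow> (\<integral>x. lim (\<lambda>k. w k x) \<partial>M)"
  proof (rule integral_dominated_convergence[where w = "\<lambda>_. C\<^sup>2"])
    show "AE x in M. (\<lambda>k. w k x) \<longlonglongrightarrow> lim (\<lambda>k. w k x)"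
      using corr AE_space by eventually_elim (rule w_lim)
    show "AE x in M. norm (w k x) \<le> C\<^sup>2" for k
      using corr AE_space by eventually_elim (use w_bd w_nonneg in simp)
  qed auto
  ultimately have int_eq: "(\<integral>x. B x \<partial>M) = (\<integral>x. lim (\<lambda>k. w k x) \<partial>M)"
    unfolding int_u using LIMSEQ_unique by blast
  have lim_le: "AE x in M. lim (\<lambda>k. w k x) \<le> C\<^sup>2 \<and> 0 \<le> lim (\<lambda>k. w k x) \<and> B x \<le> lim (\<lambda>k. w k x)"
    using corr conv AE_space
  proof eventually_elim
    case (elim x)
    have "B x \<le> w k x" for k
      unfolding B_def w_def by (rule norm_twisted_limit_le[OF elim(1) o_bd[OF elim(3)] _ nz elim(2)]) simp
    then show ?case
      using LIMSEQ_le_const[OF w_lim[OF elim(3,1)]] LIMSEQ_le_const2[OF w_lim[OF elim(3,1)]]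
        w_bd[OF elim(3,1)] w_nonneg[OF elim(1)] by meson
  qed
  have int_lim: "integrable M (\<lambda>x. lim (\<lambda>k. w k x))"
  proof (rule integrable_const_bound[of _ "C\<^sup>2"])
    show "AE x in M. norm (lim (\<lambda>k. w k x)) \<le> C\<^sup>2" using lim_le by eventually_elim auto
  qed measurable
  have int_B: "integrable M B"
  proof (rule integrable_const_bound[of _ "C\<^sup>2"])
    have "0 \<le> B x" for x by (simp add: B_def)
    then show "AE x in M. norm (B x) \<le> C\<^sup>2" using lim_le by (elim eventually_mono) (auto intro: order_trans)
  qed measurable
  have "(\<integral>x. lim (\<lambda>k. w k x) - B x \<partial>M) = 0"
    using int_eq int_lim int_B by simp
  moreover have "AE x in M. 0 \<le> lim (\<lambda>k. w k x) - B x" using lim_le by eventually_elim simp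
  ultimately have "AE x in M. lim (\<lambda>k. w k x) - B x = 0"
    using integral_nonneg_eq_0_iff_AE[of M "\<lambda>x. lim (\<lambda>k. w k x) - B x"] int_lim int_B by simp
  with corr AE_space have "AE x in M. (\<lambda>k. w k x) \<longlonglongrightarrow> B x"
  proof eventually_elim
    case (elim x)
    then show ?case using w_lim[of x] by simp
  qed
  then show ?thesis unfolding w_def B_def .
qed

end

section \<open>Double averages of trigonometrically approximable sequences\<close>

text \<open>Closeness is measured by exponential averages, not in mean square: a sequence whose
  exponential averages tend to 0 uniformly in \<open>z\<close> is approximated by the empty
  polynomial \<open>J = 0\<close>.\<close>

definition trig_approximable :: "(nat \<Rightarrow> complex) \<Rightarrow> bool" where
  "trig_approximable c \<longleftrightarrow> (\<forall>e>0. \<exists>(J :: nat) b \<zeta>. (\<forall>j. norm (\<zeta> j) = 1) \<and>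
     (\<forall>\<^sub>F N in sequentially. \<forall>z. norm z = 1 \<longrightarrow>
       norm (cesaro (\<lambda>n. (c n - (\<Sum>j<J. b j * \<zeta> j ^ n)) * z ^ n) N) \<le> e))"

lemma sum_swap_first_innermost:
  "(\<Sum>j\<in>J. \<Sum>n\<in>I. \<Sum>m\<in>K. f j n m) = (\<Sum>n\<in>I. \<Sum>m\<in>K. \<Sum>j\<in>J. f j n m)"
proof -
  have "(\<Sum>j\<in>J. \<Sum>n\<in>I. \<Sum>m\<in>K. f j n m) = (\<Sum>n\<in>I. \<Sum>j\<in>J. \<Sum>m\<in>K. f j n m)" by (rule sum.swap)
  also have "\<dots> = (\<Sum>n\<in>I. \<Sum>m\<in>K. \<Sum>j\<in>J. f j n m)" by (rule sum.cong[OF refl sum.swap])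
  finally show ?thesis .
qed

lemma sum_product_mult:
  fixes x :: "'b::comm_semiring_0"
  shows "(\<Sum>i\<in>I. f i) * (\<Sum>j\<in>J. g j) * x = (\<Sum>i\<in>I. \<Sum>j\<in>J. f i * g j * x)"
  unfolding sum_product by (simp only: sum_distrib_right)

lemma cesaro_power_convergent:
  assumes "norm w = 1"
  shows "convergent (cesaro (\<lambda>n. w ^ n :: complex))"
proof (cases "w = 1")
  case True
  have "cesaro (\<lambda>n. 1 :: complex) \<longlonglongrightarrow> 1"
    by (rule tendsto_eventually, rule eventually_sequentiallyI[of 1]) (simp add: cesaro_def)
  then show ?thesis using True by (auto simp: convergent_def)
next
  case False
  have "cesaro (\<lambda>n. w ^ n) \<longlonglongrightarrow> 0"
  proof (rule Lim_null_comparison)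
    show "\<forall>\<^sub>F N in sequentially. norm (cesaro (\<lambda>n. w ^ n) N) \<le> (2 / norm (w - 1)) / real N"
    proof (intro always_eventually allI)
      fix N
      have "norm (w ^ N - 1) \<le> 2"
        using norm_triangle_ineq4[of "w ^ N" 1] by (simp add: norm_power assms)
      then show "norm (cesaro (\<lambda>n. w ^ n) N) \<le> (2 / norm (w - 1)) / real N"
        unfolding cesaro_def geometric_sum[OF False] norm_divide
        by (simp add: divide_right_mono)
    qed
    show "(\<lambda>N. (2 / norm (w - 1)) / real N) \<longlonglongrightarrow> 0" by (rule lim_const_over_n)
  qed
  then show ?thesis by (auto simp: convergent_def)
qed

lemma convergent_if_approximated:
  fixes X :: "nat \<Rightarrow> complex"
  assumes "\<And>e. e > 0 \<Longrightarrow> \<exists>Y. convergent Y \<and> (\<forall>\<^sub>F N in sequentially. norm (X N - Y N) \<le> e)"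
  shows "convergent X"
  unfolding Cauchy_convergent_iff[symmetric]
proof (rule CauchyI)
  fix e :: real assume e: "e > 0"
  then obtain Y where Y: "convergent Y" "\<forall>\<^sub>F N in sequentially. norm (X N - Y N) \<le> e / 4"
    using assms[of "e / 4"] by auto
  then obtain N1 where N1: "\<And>n. n \<ge> N1 \<Longrightarrow> norm (X n - Y n) \<le> e / 4"
    by (auto simp: eventually_sequentially)
  have "Cauchy Y" using Y(1) by (simp add: Cauchy_convergent_iff)
  then obtain N2 where N2: "\<And>m n. m \<ge> N2 \<Longrightarrow> n \<ge> N2 \<Longrightarrow> norm (Y m - Y n) < e / 4"
    using e CauchyD[of Y "e / 4"] by auto
  show "\<exists>M. \<forall>m\<ge>M. \<forall>n\<ge>M. norm (X m - X n) < e"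
  proof (intro exI allI impI)
    fix m n assume mn: "m \<ge> max N1 N2" "n \<ge> max N1 N2"
    have "X m - X n = (X m - Y m) + (Y m - Y n) - (X n - Y n)" by simp
    also have "norm \<dots> \<le> norm (X m - Y m) + norm (Y m - Y n) + norm (X n - Y n)"
      by (meson norm_triangle_ineq norm_triangle_ineq4 add_right_mono order_trans)
    also have "\<dots> < e"
      using N1[of m] N1[of n] N2[of m n] mn e by simp
    finally show "norm (X m - X n) < e" .
  qed
qed

text \<open>The twisted averages stay close to those of a trigonometric polynomial, which converge
  as geometric sums. This supplies the limits of the two factors into which the double average
  splits.\<close>

lemma trig_approximable_convergent:
  assumes "trig_approximable c" and z: "norm z = 1"
  shows "convergent (cesaro (\<lambda>n. c n * z ^ n))"
proof (rule convergent_if_approximated)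
  fix e :: real assume "e > 0"
  from assms(1)[unfolded trig_approximable_def, THEN spec, THEN mp, OF this]
  obtain J :: nat and b \<zeta> where \<zeta>: "\<And>j. norm (\<zeta> j) = 1"
    and ev: "\<forall>\<^sub>F N in sequentially. \<forall>z. norm z = 1 \<longrightarrow>
       norm (cesaro (\<lambda>n. (c n - (\<Sum>j<J. b j * \<zeta> j ^ n)) * z ^ n) N) \<le> e"
    by blast
  define Y where "Y N = (\<Sum>j<J. b j * cesaro (\<lambda>n. (\<zeta> j * z) ^ n) N)" for N
  have "convergent Y"
    unfolding Y_def
    by (intro convergent_sum convergent_mult convergent_const cesaro_power_convergent) (simp add: norm_mult \<zeta> z)
  moreover have "cesaro (\<lambda>n. c n * z ^ n) N - Y N = cesaro (\<lambda>n. (c n - (\<Sum>j<J. b j * \<zeta> j ^ n)) * z ^ n) N" for N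
    unfolding Y_def cesaro_cmult[symmetric] cesaro_sum[symmetric] cesaro_diff[symmetric]
    by (simp only: left_diff_distrib sum_distrib_right power_mult_distrib mult.assoc)
  ultimately show "\<exists>Y. convergent Y \<and> (\<forall>\<^sub>F N in sequentially. norm (cesaro (\<lambda>n. c n * z ^ n) N - Y N) \<le> e)"
    using ev z by (intro exI[of _ Y]) (auto elim!: eventually_mono)
qed

section \<open>Fourier analysis modulo Q and the bilinear estimate\<close>

lemma sum_roots_of_unity:
  fixes Q :: nat
  assumes Q: "Q > 0"
  defines "\<omega> \<equiv> cis (2 * pi / real Q)"
  shows "p < Q \<Longrightarrow> q < Q \<Longrightarrow> (\<Sum>j<Q. (\<omega> ^ j) ^ p * cnj (\<omega> ^ j) ^ q) = (if p = q then of_nat Q else 0)"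
proof -
  assume pq: "p < Q" "q < Q"
  define w where "w = cis (2 * pi * ((real p - real q) / real Q))"
  have summand: "(\<omega> ^ j) ^ p * cnj (\<omega> ^ j) ^ q = w ^ j" for j
  proof -
    have "(\<omega> ^ j) ^ p * cnj (\<omega> ^ j) ^ q = cis (real p * (real j * (2 * pi / real Q)) + real q * (- (real j * (2 * pi / real Q))))"
      by (simp only: \<omega>_def Complex.DeMoivre cis_cnj cis_mult)
    also have "\<dots> = cis (real j * (2 * pi * ((real p - real q) / real Q)))"
      by (rule arg_cong[where f = cis]) (simp add: algebra_simps diff_divide_distrib)
    finally show ?thesis by (simp only: w_def Complex.DeMoivre)
  qed
  have wQ: "w ^ Q = 1"
  proof -
    have "w ^ Q = cis (2 * pi * of_int (int p - int q))" using Q by (simp add: w_def Complex.DeMoivre)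
    then show ?thesis by (simp only: cis_multiple_2pi Ints_of_int)
  qed
  show ?thesis
  proof (cases "p = q")
    case True
    then have "w = 1" by (simp add: w_def)
    then show ?thesis using True unfolding summand by simp
  next
    case False
    have "w \<noteq> 1"
    proof
      assume "w = 1"
      then have "cos (2 * pi * ((real p - real q) / real Q)) = 1" by (simp add: w_def complex_eq_iff)
      then obtain k :: int where "(2 * pi) * ((real p - real q) / real Q) = (2 * pi) * of_int k"
        using cos_one_2pi_int by (auto simp: mult_ac)
      then have "(real p - real q) / real Q = of_int k" by (subst (asm) mult_left_cancel) auto
      then have "real_of_int (int p - int q) = real_of_int (k * int Q)" using Q by (simp add: field_simps)
      then have k: "int p - int q = k * int Q" by (simp only: of_int_eq_iff)
      have "\<bar>k\<bar> * int Q < 1 * int Q" using pq k by (simp add: abs_mult[symmetric, of k "int Q", simplified])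
      then have "\<bar>k\<bar> < 1" using Q by (simp only: mult_less_cancel_right_pos of_nat_0_less_iff)
      then have "k = 0" by simp
      then show False using k False by simp
    qed
    then show ?thesis using False wQ unfolding summand by (simp add: geometric_sum)
  qed
qed

text \<open>Expanding the square leaves only the diagonal, by orthogonality of characters; indices
  in \<open>{..<Q}\<close> are distinct modulo \<open>Q\<close>.\<close>

lemma parseval_roots_of_unity:
  fixes Q :: nat and a :: "nat \<Rightarrow> complex"
  assumes Q: "Q > 0" and I: "I \<subseteq> {..<Q}"
  defines "\<omega> \<equiv> cis (2 * pi / real Q)"
  shows "(\<Sum>j<Q. (norm (\<Sum>n\<in>I. a n * (\<omega> ^ j) ^ n))\<^sup>2) = real Q * (\<Sum>n\<in>I. (norm (a n))\<^sup>2)"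
proof -
  have fin: "finite I" using I finite_subset by blast
  have "complex_of_real (\<Sum>j<Q. (norm (\<Sum>n\<in>I. a n * (\<omega> ^ j) ^ n))\<^sup>2)
      = (\<Sum>j<Q. \<Sum>n\<in>I. \<Sum>m\<in>I. (a n * cnj (a m)) * ((\<omega> ^ j) ^ n * cnj (\<omega> ^ j) ^ m))"
    unfolding of_real_sum complex_norm_square by (simp add: sum_product mult_ac)
  also have "\<dots> = (\<Sum>n\<in>I. \<Sum>m\<in>I. (a n * cnj (a m)) * (\<Sum>j<Q. (\<omega> ^ j) ^ n * cnj (\<omega> ^ j) ^ m))"
    unfolding sum_distrib_left by (rule sum_swap_first_innermost)
  also have "\<dots> = (\<Sum>n\<in>I. \<Sum>m\<in>I. (a n * cnj (a m)) * (if n = m then of_nat Q else 0))"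
    unfolding \<omega>_def by (intro sum.cong refl, subst sum_roots_of_unity[OF Q]) (use I in auto)
  also have "\<dots> = (\<Sum>n\<in>I. of_nat Q * (a n * cnj (a n)))"
    by (intro sum.cong refl) (simp add: fin if_distrib cong: if_cong)
  also have "\<dots> = complex_of_real (real Q * (\<Sum>n\<in>I. (norm (a n))\<^sup>2))"
    by (simp add: sum_distrib_left complex_norm_square del: of_real_power)
  finally show ?thesis by (simp only: of_real_eq_iff)
qed

text \<open>The condition \<open>k = n + m\<close> is detected by \<open>Q\<close>-th roots of
  unity, so \<open>Q\<close> times the double sum is a sum of products
  \<open>?A j * ?B j * ?R j\<close>. The last factor is at most \<open>R\<close>; the product of the
  other two is bounded by half the sum of their squares, and Parseval evaluates these.\<close>

lemma norm_bilinear_sum_le: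
  fixes a b r :: "nat \<Rightarrow> complex"
  assumes a: "\<And>n. norm (a n) \<le> A" and b: "\<And>n. norm (b n) \<le> B"
    and r: "\<And>z. norm z = 1 \<Longrightarrow> norm (\<Sum>k<2*N+1. r k * z ^ k) \<le> R"
  shows "norm (\<Sum>n=1..N. \<Sum>m=1..N. a n * b m * r (n + m)) \<le> R * (real N * (A\<^sup>2 + B\<^sup>2) / 2)"
proof -
  \<comment> \<open>The sums \<open>n + m\<close> are at most \<open>2 * N\<close>, so modulo
    \<open>2 * N + 1\<close> none of them wraps around.\<close>
  define Q where "Q = 2 * N + 1"
  define \<omega> where "\<omega> = cis (2 * pi / real Q)"
  have Q: "Q > 0" by (simp add: Q_def)
  have n\<omega>: "norm (\<omega> ^ j) = 1" for j by (simp add: \<omega>_def norm_power)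
  let ?A = "\<lambda>j. \<Sum>n=1..N. a n * (\<omega> ^ j) ^ n" and ?B = "\<lambda>j. \<Sum>n=1..N. b n * (\<omega> ^ j) ^ n"
  let ?R = "\<lambda>j. \<Sum>k<Q. r k * cnj (\<omega> ^ j) ^ k"
  have R0: "0 \<le> R" by (rule order_trans[OF norm_ge_zero r[of 1]]) simp
  have four: "(\<Sum>j<Q. ?A j * ?B j * ?R j) = of_nat Q * (\<Sum>n=1..N. \<Sum>m=1..N. a n * b m * r (n + m))"
  proof -
    have "(\<Sum>j<Q. ?A j * ?B j * ?R j) =
        (\<Sum>j<Q. \<Sum>n=1..N. \<Sum>m=1..N. \<Sum>k<Q. (a n * b m * r k) * ((\<omega> ^ j) ^ (n + m) * cnj (\<omega> ^ j) ^ k))"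
    proof (intro sum.cong refl)
      fix j
      have "?A j * ?B j * ?R j = (\<Sum>n=1..N. \<Sum>m=1..N. ((a n * (\<omega> ^ j) ^ n) * (b m * (\<omega> ^ j) ^ m)) * ?R j)"
        by (rule sum_product_mult)
      also have "\<dots> = (\<Sum>n=1..N. \<Sum>m=1..N. \<Sum>k<Q. (a n * b m * r k) * ((\<omega> ^ j) ^ (n + m) * cnj (\<omega> ^ j) ^ k))"
        unfolding sum_distrib_left by (intro sum.cong refl) (simp only: power_add mult_ac)
      finally show "?A j * ?B j * ?R j = (\<Sum>n=1..N. \<Sum>m=1..N. \<Sum>k<Q. (a n * b m * r k) * ((\<omega> ^ j) ^ (n + m) * cnj (\<omega> ^ j) ^ k))" .
    qed
    also have "\<dots> = (\<Sum>n=1..N. \<Sum>m=1..N. \<Sum>k<Q. (a n * b m * r k) * (\<Sum>j<Q. (\<omega> ^ j) ^ (n + m) * cnj (\<omega> ^ j) ^ k))"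
      unfolding sum_distrib_left
      by (rule trans[OF sum_swap_first_innermost], rule sum.cong[OF refl], rule sum.cong[OF refl], rule sum.swap)
    also have "\<dots> = (\<Sum>n=1..N. \<Sum>m=1..N. \<Sum>k<Q. (a n * b m * r k) * (if n + m = k then of_nat Q else 0))"
      unfolding \<omega>_def by (intro sum.cong refl, subst sum_roots_of_unity[OF Q]) (auto simp: Q_def)
    also have "\<dots> = (\<Sum>n=1..N. \<Sum>m=1..N. of_nat Q * (a n * b m * r (n + m)))"
      by (intro sum.cong refl) (auto simp: if_distrib Q_def cong: if_cong)
    finally show ?thesis by (simp add: sum_distrib_left)
  qed
  have R_le: "norm (?R j) \<le> R" for j
    using r[of "cnj (\<omega> ^ j)"] n\<omega>[of j] by (simp add: Q_def del: complex_cnj_power)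
  have sq: "(\<Sum>j<Q. (norm (?A j))\<^sup>2) \<le> real Q * (real N * A\<^sup>2)" "(\<Sum>j<Q. (norm (?B j))\<^sup>2) \<le> real Q * (real N * B\<^sup>2)"
  proof -
    have *: "(\<Sum>j<Q. (norm (\<Sum>n=1..N. d n * (\<omega> ^ j) ^ n))\<^sup>2) \<le> real Q * (real N * D\<^sup>2)"
      if d: "\<And>n. norm (d n) \<le> D" for d :: "nat \<Rightarrow> complex" and D
    proof -
      have "(\<Sum>j<Q. (norm (\<Sum>n=1..N. d n * (\<omega> ^ j) ^ n))\<^sup>2) = real Q * (\<Sum>n=1..N. (norm (d n))\<^sup>2)"
        unfolding \<omega>_def by (rule parseval_roots_of_unity[OF Q]) (auto simp: Q_def)
      also have "(\<Sum>n=1..N. (norm (d n))\<^sup>2) \<le> (\<Sum>n=1..N. D\<^sup>2)"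
        by (intro sum_mono power_mono d) auto
      finally show ?thesis by (simp add: mult_left_mono)
    qed
    show "(\<Sum>j<Q. (norm (?A j))\<^sup>2) \<le> real Q * (real N * A\<^sup>2)" by (rule *[OF a])
    show "(\<Sum>j<Q. (norm (?B j))\<^sup>2) \<le> real Q * (real N * B\<^sup>2)" by (rule *[OF b])
  qed
  have "real Q * norm (\<Sum>n=1..N. \<Sum>m=1..N. a n * b m * r (n + m)) = norm (\<Sum>j<Q. ?A j * ?B j * ?R j)"
    unfolding four norm_mult by simp
  also have "\<dots> \<le> (\<Sum>j<Q. R * (((norm (?A j))\<^sup>2 + (norm (?B j))\<^sup>2) / 2))"
  proof (rule sum_norm_le)
    fix j
    have "norm (?A j * ?B j * ?R j) = (norm (?A j) * norm (?B j)) * norm (?R j)" by (simp only: norm_mult)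
    also have "\<dots> \<le> (((norm (?A j))\<^sup>2 + (norm (?B j))\<^sup>2) / 2) * R"
    proof (intro mult_mono R_le)
      show "norm (?A j) * norm (?B j) \<le> ((norm (?A j))\<^sup>2 + (norm (?B j))\<^sup>2) / 2"
        using sum_squares_bound[of "norm (?A j)" "norm (?B j)"] by simp
    qed auto
    finally show "norm (?A j * ?B j * ?R j) \<le> R * (((norm (?A j))\<^sup>2 + (norm (?B j))\<^sup>2) / 2)" by (simp only: mult.commute)
  qed
  also have "\<dots> = R * (((\<Sum>j<Q. (norm (?A j))\<^sup>2) + (\<Sum>j<Q. (norm (?B j))\<^sup>2)) / 2)"
    by (simp only: sum_distrib_left[symmetric] sum_divide_distrib[symmetric] sum.distrib)
  also have "\<dots> \<le> R * ((real Q * (real N * A\<^sup>2) + real Q * (real N * B\<^sup>2)) / 2)"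
    by (intro mult_left_mono divide_right_mono add_mono sq R0) auto
  also have "\<dots> = real Q * (R * (real N * (A\<^sup>2 + B\<^sup>2) / 2))" by (simp add: algebra_simps)
  finally show ?thesis using Q by (simp only: mult_le_cancel_left_pos of_nat_0_less_iff)
qed

section \<open>From the bilinear estimate to convergence of double averages\<close>

lemma convergent_average_from_1:
  fixes c :: "nat \<Rightarrow> complex"
  assumes bd: "\<And>n. norm (c n) \<le> C" and conv: "convergent (cesaro c)"
  shows "convergent (\<lambda>N. (\<Sum>n=1..N. c n) / of_nat N)"
proof -
  have "(\<lambda>N. (\<Sum>n=1..N. c n) / of_nat N) = cesaro (\<lambda>n. c (n + 1))"
    by (rule ext) (simp add: cesaro_def sum.atLeast1_atMost_eq)
  then show ?thesis using conv cesaro_shift_iff[of c C 1, OF bd] by (auto simp: convergent_def)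
qed

text \<open>Replace \<open>c\<close> by a trigonometric polynomial. Since
  \<open>\<zeta> ^ (n + m)\<close> factors, its double average is a finite combination of products
  of twisted averages of \<open>a\<close> and of \<open>b\<close>, which converge; the bilinear
  estimate bounds the remainder.\<close>

theorem double_average_convergent:
  fixes a b c :: "nat \<Rightarrow> complex"
  assumes bda: "\<And>n. norm (a n) \<le> A" and bdb: "\<And>n. norm (b n) \<le> B"
    and a: "trig_approximable a" and b: "trig_approximable b" and c: "trig_approximable c"
  shows "convergent (\<lambda>N. 1 / (of_nat N)\<^sup>2 * (\<Sum>n=1..N. \<Sum>m=1..N. a n * b m * c (n + m)))"
proof (rule convergent_if_approximated)
  fix e :: real assume e: "e > 0"
  \<comment> \<open>The 3 comes from \<open>2 * N + 1 \<le> 3 * N\<close>, the rest of the fraction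
    from the bilinear estimate; adding 1 makes \<open>D\<close> positive.\<close>
  define D where "D = 3 * (A\<^sup>2 + B\<^sup>2) / 2 + 1"
  have D: "D > 0" by (simp add: D_def add_nonneg_pos)
  from c[unfolded trig_approximable_def, THEN spec, THEN mp, OF divide_pos_pos[OF e D]]
  obtain J :: nat and \<beta> \<zeta> where \<zeta>: "\<And>j. norm (\<zeta> j) = 1"
    and ev: "\<forall>\<^sub>F N in sequentially. \<forall>z. norm z = 1 \<longrightarrow>
       norm (cesaro (\<lambda>n. (c n - (\<Sum>j<J. \<beta> j * \<zeta> j ^ n)) * z ^ n) N) \<le> e / D"
    by blast
  define p where "p n = (\<Sum>j<J. \<beta> j * \<zeta> j ^ n)" for n
  define X where "X j N = (\<Sum>n=1..N. a n * \<zeta> j ^ n)" for j N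
  define Z where "Z j N = (\<Sum>m=1..N. b m * \<zeta> j ^ m)" for j N
  define Y where "Y N = (\<Sum>j<J. \<beta> j * ((X j N / of_nat N) * (Z j N / of_nat N)))" for N
  have "convergent Y"
    unfolding Y_def X_def Z_def
    by (intro convergent_sum convergent_mult convergent_const convergent_average_from_1[of _ A] convergent_average_from_1[of _ B]
          trig_approximable_convergent a b \<zeta>) (simp_all add: norm_mult norm_power \<zeta> bda bdb)
  have diff: "1 / (of_nat N)\<^sup>2 * (\<Sum>n=1..N. \<Sum>m=1..N. a n * b m * c (n + m)) - Y N
      = (\<Sum>n=1..N. \<Sum>m=1..N. a n * b m * (c (n + m) - p (n + m))) / (of_nat N)\<^sup>2" for N
  proof -
    have "(\<Sum>n=1..N. \<Sum>m=1..N. a n * b m * p (n + m))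
        = (\<Sum>n=1..N. \<Sum>m=1..N. \<Sum>j<J. \<beta> j * ((a n * \<zeta> j ^ n) * (b m * \<zeta> j ^ m)))"
      by (simp add: p_def sum_distrib_left power_add mult_ac)
    also have "\<dots> = (\<Sum>j<J. \<Sum>n=1..N. \<Sum>m=1..N. \<beta> j * ((a n * \<zeta> j ^ n) * (b m * \<zeta> j ^ m)))"
      by (rule sum_swap_first_innermost[symmetric])
    also have "\<dots> = (\<Sum>j<J. \<beta> j * (X j N * Z j N))"
      unfolding X_def Z_def by (rule sum.cong[OF refl]) (unfold sum_product, simp only: sum_distrib_left)
    finally have Y: "Y N = (\<Sum>n=1..N. \<Sum>m=1..N. a n * b m * p (n + m)) / (of_nat N)\<^sup>2"
      unfolding Y_def by (simp add: sum_divide_distrib power2_eq_square)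
    show ?thesis unfolding Y
      by (simp add: right_diff_distrib sum_subtractf diff_divide_distrib)
  qed
  obtain N0 where N0: "\<And>N z. N \<ge> N0 \<Longrightarrow> norm z = 1 \<Longrightarrow>
      norm (cesaro (\<lambda>n. (c n - p n) * z ^ n) N) \<le> e / D"
    using ev unfolding eventually_sequentially p_def by blast
  have "norm (1 / (of_nat N)\<^sup>2 * (\<Sum>n=1..N. \<Sum>m=1..N. a n * b m * c (n + m)) - Y N) \<le> e" if N: "N \<ge> max 1 N0" for N
  proof -
    have "norm (\<Sum>k<2*N+1. (c k - p k) * z ^ k) \<le> 3 * real N * (e / D)" if z: "norm z = 1" for z
    proof -
      have "norm (\<Sum>k<2*N+1. (c k - p k) * z ^ k) = real (2*N+1) * norm (cesaro (\<lambda>n. (c n - p n) * z ^ n) (2*N+1))"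
        by (simp add: cesaro_def norm_divide del: of_nat_add of_nat_mult of_nat_Suc)
      also have "\<dots> \<le> real (2*N+1) * (e / D)"
        using N by (intro mult_left_mono N0 z) auto
      also have "\<dots> \<le> 3 * real N * (e / D)"
        using N e D by (intro mult_right_mono) auto
      finally show ?thesis .
    qed
    then have "norm (\<Sum>n=1..N. \<Sum>m=1..N. a n * b m * (c (n + m) - p (n + m))) \<le> (3 * real N * (e / D)) * (real N * (A\<^sup>2 + B\<^sup>2) / 2)"
      by (intro norm_bilinear_sum_le[where r = "\<lambda>k. c k - p k"] bda bdb)
    also have "\<dots> = (real N)\<^sup>2 * ((e / D) * (D - 1))"
      by (simp add: D_def power2_eq_square)
    also have "\<dots> \<le> (real N)\<^sup>2 * ((e / D) * D)"
      using e D by (intro mult_left_mono) auto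
    also have "\<dots> = (real N)\<^sup>2 * e" using D by simp
    finally show ?thesis
      unfolding diff norm_divide norm_power using N by (simp add: field_simps)
  qed
  then show "\<exists>Y. convergent Y \<and> (\<forall>\<^sub>F N in sequentially.
      norm (1 / (of_nat N)\<^sup>2 * (\<Sum>n=1..N. \<Sum>m=1..N. a n * b m * c (n + m)) - Y N) \<le> e)"
    using \<open>convergent Y\<close> by (intro exI[of _ Y] conjI eventually_sequentiallyI[of "max 1 N0"])
qed

section \<open>Removing frequencies one by one\<close>

context mpt
begin

text \<open>\<open>g'\<close> is what remains of \<open>g\<close> after its strongest exponential
  along the orbit of \<open>x\<close> is removed. The last clause says that no frequency carries
  more than the square of \<open>norm (b x)\<close>, in the form the van der Corput bound needs: one
  \<open>K\<close> for all \<open>w\<close>.\<close>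

definition dominant_split :: "('a \<Rightarrow> complex) \<Rightarrow> ('a \<Rightarrow> complex) \<Rightarrow> ('a \<Rightarrow> complex) \<Rightarrow> ('a \<Rightarrow> complex) \<Rightarrow> 'a \<Rightarrow> bool" where
  "dominant_split g g' b z x \<longleftrightarrow> has_correlations (orbit g x) \<and> norm (z x) = 1 \<and>
     cesaro (\<lambda>n. orbit g x n * z x ^ n) \<longlonglongrightarrow> b x \<and>
     (\<forall>n. orbit g' x n = orbit g x n - b x * cnj (z x) ^ n) \<and>
     (\<forall>e>(norm (b x))\<^sup>2. \<exists>K>0. \<forall>w. norm w = 1 \<longrightarrow> block_energy (orbit g x) K w < e)"

text \<open>The limit \<open>b\<close> of the averages twisted by the maximal frequency satisfies
  \<open>b (T x) = b x * cnj (z x)\<close> almost everywhere. Hence removing one exponential from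
  almost every orbit amounts to subtracting a bounded function, and the remainder can be split
  again.\<close>

lemma exists_dominant_split:
  assumes [measurable]: "g \<in> borel_measurable M" and bd: "\<And>x. x \<in> space M \<Longrightarrow> norm (g x) \<le> C"
  shows "\<exists>g' b z. g' \<in> borel_measurable M \<and> (\<forall>x\<in>space M. norm (g' x) \<le> 2 * C) \<and>
    (AE x in M. dominant_split g g' b z x)"
proof -
  obtain \<theta> where [measurable]: "\<theta> \<in> borel_measurable M" and inv: "\<And>x. x \<in> space M \<Longrightarrow> \<theta> (T x) = \<theta> x"
    and dom: "\<And>x e k. \<lbrakk>x \<in> space M; has_correlations (orbit g x);
      block_energy (orbit g x) (2 ^ k) (cis (2 * pi * \<theta> x)) < e\<rbrakk>
      \<Longrightarrow> \<exists>K>0. \<forall>w. norm w = 1 \<longrightarrow> block_energy (orbit g x) K w < e"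
    using exists_maximal_frequency[of g C] bd by auto
  define z where "z x = cis (2 * pi * \<theta> x)" for x
  have nz: "norm (z x) = 1" for x by (simp add: z_def)
  have z1: "cnj (z x) ^ n * z x ^ n = 1" for x n
  proof -
    have "cnj (z x) * z x = 1" using complex_norm_square[of "z x"] nz[of x] by (simp add: mult.commute)
    then show ?thesis by (metis power_mult_distrib power_one)
  qed
  have z_inv: "z ((T ^^ n) x) = z x" if "x \<in> space M" for x n
    by (induction n) (use that inv in \<open>auto simp: z_def\<close>)
  have [measurable]: "z \<in> borel_measurable M" unfolding z_def by measurable
  define X where "X x = cesaro (\<lambda>n. orbit g x n * z x ^ n)" for x
  \<comment> \<open>The default 0 keeps \<open>b\<close> bounded by \<open>C\<close> on the whole
    space, and the Cauchy condition describes convergence by a measurable set.\<close>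
  define b where "b x = (if Cauchy (X x) then lim (X x) else 0)" for x
  have X_meas [measurable]: "(\<lambda>x. X x N) \<in> borel_measurable M" for N
    unfolding X_def cesaro_def by measurable
  have X_bd: "norm (X x N) \<le> C" if "x \<in> space M" for x N
    unfolding X_def by (rule norm_cesaro_le) (use that bd in \<open>simp add: norm_mult norm_power nz orbit_def\<close>)
  have [measurable]: "b \<in> borel_measurable M"
  proof -
    have "{x \<in> space M. Cauchy (\<lambda>N. X x N)} \<in> sets M" by (rule sets_Collect_Cauchy) measurable
    moreover have "(\<lambda>x. lim (\<lambda>N. X x N)) \<in> borel_measurable M" by (rule borel_measurable_lim_metric) measurable
    ultimately show ?thesis unfolding b_def by (intro measurable_If) auto
  qed
  have b_lim: "X x \<longlonglongrightarrow> b x" if "convergent (X x)" for x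
    using that by (simp add: b_def Cauchy_convergent_iff convergent_LIMSEQ_iff)
  have b_bd: "norm (b x) \<le> C" if x: "x \<in> space M" for x
  proof (cases "convergent (X x)")
    case True
    show ?thesis
      by (rule LIMSEQ_le_const2[OF tendsto_norm[OF b_lim[OF True]]]) (use X_bd[OF x] in auto)
  next
    case False
    then show ?thesis using order_trans[OF norm_ge_zero bd[OF x]] by (simp add: b_def Cauchy_convergent_iff)
  qed
  \<comment> \<open>Starting from the \<open>n\<close>-th orbit point shifts the twisted average and
    removes the phase \<open>z x ^ n\<close>, so the limit is multiplied by
    \<open>cnj (z x) ^ n\<close>.\<close>
  have b_T: "b ((T ^^ n) x) = b x * cnj (z x) ^ n" if x: "x \<in> space M" and conv: "convergent (X x)" for x n
  proof -
    let ?d = "\<lambda>i. orbit g x i * z x ^ i"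
    have "norm (?d i) \<le> C" for i using x bd by (simp add: norm_mult norm_power nz orbit_def)
    then have "cesaro (\<lambda>i. ?d (i + n)) \<longlonglongrightarrow> b x"
      using cesaro_shift_iff[of ?d C n "b x"] b_lim[OF conv] by (simp add: X_def)
    then have "(\<lambda>N. cnj (z x) ^ n * cesaro (\<lambda>i. ?d (i + n)) N) \<longlonglongrightarrow> cnj (z x) ^ n * b x"
      by (intro tendsto_intros)
    moreover have "cnj (z x) ^ n * cesaro (\<lambda>i. ?d (i + n)) N = X ((T ^^ n) x) N" for N
    proof -
      have "cnj (z x) ^ n * ?d (i + n) = orbit g x (i + n) * z x ^ i" for i
      proof -
        have "cnj (z x) ^ n * ?d (i + n) = orbit g x (i + n) * z x ^ i * (cnj (z x) ^ n * z x ^ n)"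
          by (simp only: power_add mult_ac)
        then show ?thesis by (simp only: z1 mult_1_right)
      qed
      then show ?thesis
        unfolding cesaro_cmult[symmetric] X_def by (simp only: orbit_T_pow z_inv[OF x])
    qed
    ultimately have lim: "X ((T ^^ n) x) \<longlonglongrightarrow> cnj (z x) ^ n * b x" by simp
    then have "X ((T ^^ n) x) \<longlonglongrightarrow> b ((T ^^ n) x)"
      by (intro b_lim) (auto simp: convergent_def)
    from LIMSEQ_unique[OF this lim] show ?thesis by (simp add: mult.commute)
  qed
  define g' where "g' x = g x - b x" for x
  have "AE x in M. dominant_split g g' b z x"
  proof -
    have conv: "AE x in M. convergent (X x)"
      using birkhoff_twisted[of g \<theta> C] bd inv by (simp add: X_def orbit_def z_def)
    have energy: "AE x in M. (\<lambda>k. block_energy (orbit g x) (2 ^ k) (z x)) \<longlonglongrightarrow> (norm (lim (X x)))\<^sup>2"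
      unfolding X_def z_def by (rule AE_twisted_limit_energy[where C = C]) (use bd inv in auto)
    have corr: "AE x in M. has_correlations (orbit g x)"
      by (rule AE_has_correlations) (use bd in auto)
    from conv energy corr AE_space show ?thesis
    proof eventually_elim
      case (elim x)
      have lim: "X x \<longlonglongrightarrow> b x" by (rule b_lim) fact
      have energy: "(\<lambda>k. block_energy (orbit g x) (2 ^ k) (z x)) \<longlonglongrightarrow> (norm (b x))\<^sup>2"
        using elim(2) limI[OF lim] by simp
      show ?case
        unfolding dominant_split_def
      proof (intro conjI allI impI)
        show "cesaro (\<lambda>n. orbit g x n * z x ^ n) \<longlonglongrightarrow> b x" using lim by (simp add: X_def)
        show "orbit g' x n = orbit g x n - b x * cnj (z x) ^ n" for n
          using b_T[OF elim(4,1)] by (simp add: orbit_def g'_def)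
        show "\<exists>K>0. \<forall>w. norm w = 1 \<longrightarrow> block_energy (orbit g x) K w < e" if "(norm (b x))\<^sup>2 < e" for e
        proof -
          have "\<forall>\<^sub>F k in sequentially. block_energy (orbit g x) (2 ^ k) (z x) < e"
            by (rule order_tendstoD(2)[OF energy that])
          then obtain k where "block_energy (orbit g x) (2 ^ k) (z x) < e"
            by (auto simp: eventually_sequentially)
          then show ?thesis by (intro dom[OF elim(4,3)]) (simp add: z_def)
        qed
      qed (use elim nz in auto)
    qed
  qed
  moreover have "norm (g' x) \<le> 2 * C" if "x \<in> space M" for x
    using norm_triangle_ineq4[of "g x" "b x"] bd[OF that] b_bd[OF that] by (simp add: g'_def)
  moreover have "g' \<in> borel_measurable M" unfolding g'_def by measurable
  ultimately show ?thesis by blast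
qed

text \<open>Splitting repeatedly produces coefficients \<open>b j x\<close> whose squares sum to at
  most the mean square of the orbit. Some \<open>J\<close> therefore has a small coefficient, so the
  remainder after removing \<open>J\<close> exponentials has uniformly small exponential
  averages.\<close>

theorem AE_trig_approximable:
  assumes f: "f \<in> borel_measurable M" and bd: "\<And>x. x \<in> space M \<Longrightarrow> norm (f x) \<le> C"
  shows "AE x in M. trig_approximable (orbit f x)"
proof -
  define good where "good g \<longleftrightarrow> g \<in> borel_measurable M \<and> (\<exists>C. \<forall>x\<in>space M. norm (g x) \<le> C)" for g :: "'a \<Rightarrow> complex"
  have "\<exists>G. \<forall>j. (good (G j) \<and> (j = 0 \<longrightarrow> G j = f)) \<and> (\<exists>b z. AE x in M. dominant_split (G j) (G (Suc j)) b z x)"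
  proof (rule dependent_nat_choice)
    show "\<exists>g. good g \<and> (0 = (0::nat) \<longrightarrow> g = f)" using f bd by (auto simp: good_def)
    fix g and j :: nat
    assume "good g \<and> (j = 0 \<longrightarrow> g = f)"
    then obtain C' where "g \<in> borel_measurable M" "\<And>x. x \<in> space M \<Longrightarrow> norm (g x) \<le> C'"
      by (auto simp: good_def)
    from exists_dominant_split[OF this]
    show "\<exists>g'. (good g' \<and> (Suc j = 0 \<longrightarrow> g' = f)) \<and> (\<exists>b z. AE x in M. dominant_split g g' b z x)"
      unfolding good_def by auto
  qed
  then obtain G where G: "\<forall>j. (good (G j) \<and> (j = 0 \<longrightarrow> G j = f)) \<and>
      (\<exists>b z. AE x in M. dominant_split (G j) (G (Suc j)) b z x)" by blast
  then have good_G: "good (G j)" and G0: "G 0 = f" for j by auto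
  from G obtain b z where "\<And>j. AE x in M. dominant_split (G j) (G (Suc j)) (b j) (z j) x" by metis
  then have "AE x in M. \<forall>j. dominant_split (G j) (G (Suc j)) (b j) (z j) x"
    by (simp add: AE_all_countable)
  then show ?thesis
  proof (rule AE_mp, intro AE_I2 impI)
    fix x assume x: "x \<in> space M" and ds: "\<forall>j. dominant_split (G j) (G (Suc j)) (b j) (z j) x"
    let ?c = "\<lambda>j. orbit (G j) x"
    have corr: "has_correlations (?c j)" and nz: "norm (z j x) = 1"
      and lim: "cesaro (\<lambda>n. ?c j n * z j x ^ n) \<longlonglongrightarrow> b j x"
      and step: "?c (Suc j) n = ?c j n - b j x * cnj (z j x) ^ n"
      and small: "(norm (b j x))\<^sup>2 < e \<Longrightarrow> \<exists>K>0. \<forall>w. norm w = 1 \<longrightarrow> block_energy (?c j) K w < e" for j n e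
      using spec[OF ds, of j] unfolding dominant_split_def by blast+
    define E where "E = lim (cesaro (\<lambda>n. (norm (?c 0 n))\<^sup>2))"
    have c_eq: "?c J n = ?c 0 n - (\<Sum>j<J. b j x * cnj (z j x) ^ n)" for J n
      by (induction J) (simp_all add: step)
    have E0: "cesaro (\<lambda>n. (norm (?c 0 n))\<^sup>2) \<longlonglongrightarrow> E"
    proof -
      \<comment> \<open>A block of length 1 is a single term, so the existence of the mean square is
        a special case of the block energy limit.\<close>
      have "cesaro (\<lambda>n. (norm (block_mean (?c 0) 1 1 n))\<^sup>2) \<longlonglongrightarrow> block_energy (?c 0) 1 1"
        by (rule block_energy_limit) (simp_all add: corr)
      then have "cesaro (\<lambda>n. (norm (?c 0 n))\<^sup>2) \<longlonglongrightarrow> block_energy (?c 0) 1 1"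
        by (simp add: block_mean_def cesaro_def[of _ "Suc 0"])
      then show ?thesis unfolding E_def using limI by metis
    qed
    have EJ: "cesaro (\<lambda>n. (norm (?c J n))\<^sup>2) \<longlonglongrightarrow> E - (\<Sum>j<J. (norm (b j x))\<^sup>2)" for J
    proof (induction J)
      case (Suc J)
      have "cesaro (\<lambda>n. (norm (?c J n - b J x * cnj (z J x) ^ n))\<^sup>2) \<longlonglongrightarrow>
          (E - (\<Sum>j<J. (norm (b j x))\<^sup>2)) - (norm (b J x))\<^sup>2"
        by (rule energy_remove_frequency[OF nz lim Suc])
      then show ?case by (simp add: step diff_diff_add)
    qed (use E0 in simp)
    \<comment> \<open>Bessel's inequality: the energy left after \<open>J\<close> removals is a
      limit of nonnegative averages.\<close>
    have sum_le: "(\<Sum>j<J. (norm (b j x))\<^sup>2) \<le> E" for J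
    proof -
      have "0 \<le> E - (\<Sum>j<J. (norm (b j x))\<^sup>2)"
        by (rule LIMSEQ_le_const[OF EJ]) (auto simp: cesaro_def intro!: exI[of _ 0] divide_nonneg_nonneg sum_nonneg)
      then show ?thesis by simp
    qed
    have "summable (\<lambda>j. (norm (b j x))\<^sup>2)"
    proof (rule bounded_imp_summable)
      show "(\<Sum>j\<le>J. (norm (b j x))\<^sup>2) \<le> E" for J
        using sum_le[of "Suc J"] by (simp only: lessThan_Suc_atMost)
    qed simp
    then have b0: "(\<lambda>j. (norm (b j x))\<^sup>2) \<longlonglongrightarrow> 0" by (rule summable_LIMSEQ_zero)
    show "trig_approximable (orbit f x)"
      unfolding trig_approximable_def
    proof (intro allI impI)
      fix e :: real assume e: "e > 0"
      \<comment> \<open>Half of the square of \<open>e\<close> is spent on the block energy, the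
        other half on the van der Corput error.\<close>
      have "\<forall>\<^sub>F j in sequentially. (norm (b j x))\<^sup>2 < e\<^sup>2 / 2"
        using b0 by (rule order_tendstoD(2)) (use e in simp)
      then obtain J where "(norm (b J x))\<^sup>2 < e\<^sup>2 / 2" by (auto simp: eventually_sequentially)
      from small[OF this] obtain K where K: "K > 0" "\<And>w. norm w = 1 \<Longrightarrow> block_energy (?c J) K w < e\<^sup>2 / 2"
        by blast
      \<comment> \<open>This bound may grow with \<open>J\<close>; it affects only how large
        \<open>N\<close> must be, since \<open>J\<close> is fixed by now.\<close>
      obtain C' where "\<forall>x\<in>space M. norm (G J x) \<le> C'" using good_G[of J] by (auto simp: good_def)
      then have C': "norm (?c J n) \<le> C'" for n using x by (simp add: orbit_def)
      from van_der_corput_uniform[OF corr C' K(1), of "e\<^sup>2 / 2"]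
      have "\<forall>\<^sub>F N in sequentially. \<forall>w. norm w = 1 \<longrightarrow> (norm (cesaro (\<lambda>n. ?c J n * w ^ n) N))\<^sup>2 < block_energy (?c J) K w + e\<^sup>2 / 2"
        using e by simp
      then have "\<forall>\<^sub>F N in sequentially. \<forall>w. norm w = 1 \<longrightarrow> norm (cesaro (\<lambda>n. ?c J n * w ^ n) N) \<le> e"
      proof eventually_elim
        case (elim N)
        show ?case
        proof (intro allI impI)
          fix w :: complex assume w: "norm w = 1"
          have "(norm (cesaro (\<lambda>n. ?c J n * w ^ n) N))\<^sup>2 \<le> e\<^sup>2"
            using elim w K(2)[OF w] by fastforce
          then show "norm (cesaro (\<lambda>n. ?c J n * w ^ n) N) \<le> e"
            by (rule power2_le_imp_le) (use e in simp)
        qed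
      qed
      then show "\<exists>(J :: nat) b \<zeta>. (\<forall>j. norm (\<zeta> j) = 1) \<and> (\<forall>\<^sub>F N in sequentially. \<forall>w. norm w = 1 \<longrightarrow>
          norm (cesaro (\<lambda>n. (orbit f x n - (\<Sum>j<J. b j * \<zeta> j ^ n)) * w ^ n) N) \<le> e)"
        unfolding c_eq[of J] G0
        \<comment> \<open>The polynomial has the conjugate frequencies, because \<open>z j x\<close>
          was the twist that cancelled them.\<close>
        by (intro exI[of _ J] exI[of _ "\<lambda>j. b j x"] exI[of _ "\<lambda>j. cnj (z j x)"]) (simp add: nz)
    qed
  qed
qed

end

section \<open>Double averages along the three orbits of almost every point\<close>

theorem theorem1:
  fixes M :: "'a measure"
    and T1 T2 T3 :: "'a \<Rightarrow> 'a"
    and f1 f2 f3 :: "'a \<Rightarrow> complex"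
  assumes "prob_space M"
    and "measure_preserving M T1"
    and "measure_preserving M T2"
    and "measure_preserving M T3"
    and "f1 \<in> borel_measurable M" and "bounded (f1 ` space M)"
    and "f2 \<in> borel_measurable M" and "bounded (f2 ` space M)"
    and "f3 \<in> borel_measurable M" and "bounded (f3 ` space M)"
  shows "AE x in M. convergent (\<lambda>N::nat. 1 / (of_nat N)\<^sup>2 *
           (\<Sum>n=1..N. \<Sum>m=1..N.
              f1 ((T1 ^^ n) x) * f2 ((T2 ^^ m) x) * f3 ((T3 ^^ (n + m)) x)))"
proof -
  have mpt: "mpt M T" if "measure_preserving M T" for T
    using assms(1) that by (simp add: mpt_def mpt_axioms_def)
  interpret T1: mpt M T1 by (rule mpt) fact
  interpret T2: mpt M T2 by (rule mpt) fact
  interpret T3: mpt M T3 by (rule mpt) fact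
  obtain C1 C2 C3 where C: "\<And>x. x \<in> space M \<Longrightarrow> norm (f1 x) \<le> C1"
      "\<And>x. x \<in> space M \<Longrightarrow> norm (f2 x) \<le> C2" "\<And>x. x \<in> space M \<Longrightarrow> norm (f3 x) \<le> C3"
    using assms(6,8,10) unfolding bounded_iff by (metis imageI)
  \<comment> \<open>Each transformation is treated on its own; the three orbits meet only in the
    convergence theorem for sequences, applied at a fixed \<open>x\<close>.\<close>
  have "AE x in M. trig_approximable (T1.orbit f1 x)"
    using assms(5) C(1) by (rule T1.AE_trig_approximable)
  moreover have "AE x in M. trig_approximable (T2.orbit f2 x)"
    using assms(7) C(2) by (rule T2.AE_trig_approximable)
  moreover have "AE x in M. trig_approximable (T3.orbit f3 x)"
    using assms(9) C(3) by (rule T3.AE_trig_approximable)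
  ultimately show ?thesis
    using AE_space
  proof eventually_elim
    case (elim x)
    have "convergent (\<lambda>N. 1 / (of_nat N)\<^sup>2 *
        (\<Sum>n=1..N. \<Sum>m=1..N. T1.orbit f1 x n * T2.orbit f2 x m * T3.orbit f3 x (n + m)))"
    proof (rule double_average_convergent)
      show "norm (T1.orbit f1 x n) \<le> C1" "norm (T2.orbit f2 x n) \<le> C2" for n
        using elim C by (simp_all add: T1.orbit_def T2.orbit_def)
    qed (use elim in auto)
    then show ?case by (simp only: T1.orbit_def T2.orbit_def T3.orbit_def)
  qed
qed

end
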